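(* (Maximal solutions, uniqueness) Let $V\subset\mathbb{R}\times C_n$ be open and let $g:V\to\mathbb{R}^n$ be $C^1_{\ast}$-smooth. For every $(t,t_0,\phi)\in dom$ there exists a solution $x=x^{t_0,\phi}$ of the initial value problem $$x'(\tau)=g(\tau,x_\tau)\quad\text{for}\quad \tau\ge t_0,\qquad x_{t_0}=\phi,$$ so that any other solution of the same initial value problem is a restriction of $x$, and $P(t,t_0,\phi)=x_t$.
   Context: For $m\in\mathbb{N}$, $C_m=C((-\infty,0],\mathbb{R}^m)$ is the Fréchet space of continuous maps $(-\infty,0]\to\mathbb{R}^m$ with the topology of locally uniform convergence. Fix $n\in\mathbb{N}$. The symbol $\ast$ is either $MB$ or $F$ (the result holds in each case). Smoothness: Let $X,W$ be topological vector spaces, $O\subset X$ open, $h:O\to W$ continuous, $Dh(u)v=\lim_{0\neq t\to0}\frac1t(h(u+tv)-h(u))$. The map $h$ is $C^1_{MB}$-smooth if all directional derivatives exist and $O\times X\ni(u,v)\mapsto Dh(u)v\in W$ is continuous. It is $C^1_F$-smooth if all directional derivatives exist, each $Dh(u):X\to W$ is linear and continuous, and $O\ni u\mapsto Dh(u)\in L_c(X,W)$ is continuous with respect to the topology of uniform convergence on bounded sets on the space $L_c(X,W)$ of continuous linear maps. Segments: $x_t(s)=x(t+s)$, $s\le0$. A solution of $x'(t)=g(t,x_t)$ on an interval $I\subset\mathbb{R}$ is a map $x:(-\infty,0]+I\to\mathbb{R}^n$ such that $(t,x_t)\in V$ for all $t\in I$, $x|_I$ is differentiable, and the equation holds for all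 $t\in I$ (right derivative at $\min I$ if it exists). For $(t_0,\phi)\in V$ a solution of the initial value problem $x'(t)=g(t,x_t)$ for $t\ge t_0$, $x_{t_0}=\phi$, is a solution $x$ of the equation on some interval $[t_0,t_e)$, $t_0<t_e\le\infty$, with $x_{t_0}=\phi$. For $t\in\mathbb{R}$ define $t_{\ast}\in C_1$ by $t_{\ast}(u)=t+u$. Identify $C_{n+1}=C_1\times C_n$, let $\psi_1$ denote the first component of $\psi\in C_{n+1}$, and let $p_n:C_{n+1}\to C_n$ be the continuous linear map forgetting the first component. Set $U_g=\{\psi\in C_{n+1}:(\psi_1(0),p_n\psi)\in V\}$ and $f_g:U_g\to\mathbb{R}^{n+1}$, $f_g(\psi)=(1,g(\psi_1(0),p_n\psi))$. A solution of $y'(t)=f_g(y_t)$ on an interval $I$ is a continuous map $y:(-\infty,0]+I\to\mathbb{R}^{n+1}$ with $y_t\in U_g$ for all $t\in I$, $y|_I$ differentiable, and $y'(t)=f_g(y_t)$ for all $t\in I$. For each $\psi\in U_g$ there is a unique maximal solution $y^{\psi}$ on some interval $[0,t_\psi)$, $0<t_\psi\le\infty$, with $y^\psi_0=\psi$. Set $\Omega_g=\{(t,\psi)\in[0,\infty)\times U_g:t<t_\psi\}$ and $\Sigma_g:\Omega_g\to U_g$, $\Sigma_g(t,\psi)=y^\psi_t$. Finally $$dom=\{(t,t_0,\phi)\in\mathbb{R}^2\times C_n:t_0\le t,\ (t-t_0,t_{0\ast},\phi)\in\Omega_g\},\qquad P:dom\to C_n,\ P(t,t_0,\phi)=p_n\Sigma_g(t-t_0,t_{0\ast},\phi),$$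 where $(s,t_{0\ast},\phi)$ stands for $(s,(t_{0\ast},\phi))\in[0,\infty)\times C_{n+1}$. *)

theory Defs
  imports "HOL-Analysis.Analysis"
begin

section \<open>Topological vector spaces\<close>

class topological_real_vector = real_vector + topological_ab_group_add +
  assumes tendsto_scaleR_nhds:
    "((\<lambda>p. fst p *\<^sub>R snd p) \<longlongrightarrow> (c *\<^sub>R x)) (nhds c \<times>\<^sub>F nhds x)"

instance real_normed_vector \<subseteq> topological_real_vector
proof
  fix c :: real and x :: 'a
  show "((\<lambda>p. fst p *\<^sub>R snd p) \<longlongrightarrow> (c *\<^sub>R x)) (nhds c \<times>\<^sub>F nhds x)"
    by (intro tendsto_scaleR filterlim_fst filterlim_snd)
qed

lemma tendsto_scaleR_tvs:
  fixes x :: "'a::topological_real_vector"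
  assumes "(f \<longlongrightarrow> c) F" "(g \<longlongrightarrow> x) F"
  shows "((\<lambda>t. f t *\<^sub>R g t) \<longlongrightarrow> c *\<^sub>R x) F"
proof -
  have "filterlim (\<lambda>t. (f t, g t)) (nhds c \<times>\<^sub>F nhds x) F"
    using assms by (intro filterlim_Pair)
  from filterlim_compose[OF tendsto_scaleR_nhds this] show ?thesis by simp
qed

instance prod :: (topological_monoid_add, topological_monoid_add) topological_monoid_add
proof
  fix a b :: "'a \<times> 'b"
  have 1: "(fst \<longlongrightarrow> x) (nhds x \<times>\<^sub>F nhds y)" "(snd \<longlongrightarrow> y) (nhds x \<times>\<^sub>F nhds y)"
    for x y :: "'a \<times> 'b"
    by (intro filterlim_fst filterlim_snd)+
  note 2 = tendsto_fst[OF 1(1)] tendsto_fst[OF 1(2)] tendsto_snd[OF 1(1)] tendsto_snd[OF 1(2)]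
  show "((\<lambda>x. fst x + snd x) \<longlongrightarrow> a + b) (nhds a \<times>\<^sub>F nhds b)"
    unfolding plus_prod_def by (intro tendsto_Pair tendsto_add 2)
qed

instance prod :: (topological_comm_monoid_add, topological_comm_monoid_add) topological_comm_monoid_add ..

instance prod :: (topological_group_add, topological_group_add) topological_group_add
proof
  fix a :: "'a \<times> 'b"
  have "((\<lambda>x. x) \<longlongrightarrow> a) (nhds a)"
    by (rule filterlim_ident)
  then show "(uminus \<longlongrightarrow> - a) (nhds a)"
    unfolding uminus_prod_def by (intro tendsto_Pair tendsto_minus tendsto_fst tendsto_snd)
qed

instance prod :: (topological_ab_group_add, topological_ab_group_add) topological_ab_group_add ..

instance prod :: (topological_real_vector, topological_real_vector) topological_real_vector
proof
  fix c :: real and x :: "'a \<times> 'b"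
  have f: "(fst \<longlongrightarrow> c) (nhds c \<times>\<^sub>F nhds x)" and s: "(snd \<longlongrightarrow> x) (nhds c \<times>\<^sub>F nhds x)"
    by (intro filterlim_fst filterlim_snd)+
  show "((\<lambda>p. fst p *\<^sub>R snd p) \<longlongrightarrow> (c *\<^sub>R x)) (nhds c \<times>\<^sub>F nhds x)"
    unfolding scaleR_prod_def
    by (intro tendsto_Pair tendsto_scaleR_tvs f tendsto_fst[OF s] tendsto_snd[OF s])
qed

definition tvs_bounded :: "'a::topological_real_vector set \<Rightarrow> bool" where
  "tvs_bounded B \<longleftrightarrow>
     (\<forall>N. open N \<and> 0 \<in> N \<longrightarrow> (\<exists>r>0. \<forall>c\<ge>r. B \<subseteq> (\<lambda>x. c *\<^sub>R x) ` N))"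


section \<open>The two notions of \<open>C\<^sup>1\<close>-smoothness\<close>

definition dir_quotient ::
    "('a::topological_real_vector \<Rightarrow> 'b::topological_real_vector) \<Rightarrow> 'a \<Rightarrow> 'a \<Rightarrow> real \<Rightarrow> 'b" where
  "dir_quotient h u v t = (1 / t) *\<^sub>R (h (u + t *\<^sub>R v) - h u)"

definition has_dir_derivs ::
    "'a::topological_real_vector set \<Rightarrow> ('a \<Rightarrow> 'b::topological_real_vector) \<Rightarrow> bool" where
  "has_dir_derivs U h \<longleftrightarrow> (\<forall>u\<in>U. \<forall>v. \<exists>d. (dir_quotient h u v \<longlongrightarrow> d) (at 0))"

text \<open>\<open>Dh h u v\<close> is meaningful where the limit exists, cf. \<^const>\<open>has_dir_derivs\<close>.\<close>
definition Dh ::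
    "('a::topological_real_vector \<Rightarrow> 'b::{topological_real_vector,t2_space}) \<Rightarrow> 'a \<Rightarrow> 'a \<Rightarrow> 'b" where
  "Dh h u v = Lim (at 0) (dir_quotient h u v)"

definition C1_MB ::
    "'a::topological_real_vector set \<Rightarrow> ('a \<Rightarrow> 'b::{topological_real_vector,t2_space}) \<Rightarrow> bool" where
  "C1_MB U h \<longleftrightarrow> open U \<and> continuous_on U h \<and> has_dir_derivs U h \<and>
     continuous_on (U \<times> UNIV) (\<lambda>(u, v). Dh h u v)"

definition cont_linear_maps ::
    "('a::topological_real_vector \<Rightarrow> 'b::topological_real_vector) set" where
  "cont_linear_maps = {T. linear T \<and> continuous_on UNIV T}"

text \<open>The topology of uniform convergence on bounded sets. A neighbourhood base at \<open>T\<close> is given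
  by the sets of all \<open>T'\<close> with \<open>(T' - T)(B) \<subseteq> N\<close>, for \<open>B\<close> bounded and \<open>N\<close> a neighbourhood of \<open>0\<close>;
  these sets are in general not open, hence the definition by neighbourhoods.\<close>
definition Lc_open ::
    "('a::topological_real_vector \<Rightarrow> 'b::topological_real_vector) set \<Rightarrow> bool" where
  "Lc_open S \<longleftrightarrow> S \<subseteq> cont_linear_maps \<and>
     (\<forall>T\<in>S. \<exists>B N. tvs_bounded B \<and> open N \<and> 0 \<in> N \<and>
        {T' \<in> cont_linear_maps. \<forall>v\<in>B. T' v - T v \<in> N} \<subseteq> S)"

definition Lc_topology ::
    "('a::topological_real_vector \<Rightarrow> 'b::topological_real_vector) topology" where
  "Lc_topology = topology Lc_open"

lemma tvs_bounded_Un: "tvs_bounded A \<Longrightarrow> tvs_bounded B \<Longrightarrow> tvs_bounded (A \<union> B)"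
  unfolding tvs_bounded_def
proof (intro allI impI)
  fix N :: "'a set"
  assume A: "\<forall>N. open N \<and> 0 \<in> N \<longrightarrow> (\<exists>r>0. \<forall>c\<ge>r. A \<subseteq> (*\<^sub>R) c ` N)"
    and B: "\<forall>N. open N \<and> 0 \<in> N \<longrightarrow> (\<exists>r>0. \<forall>c\<ge>r. B \<subseteq> (*\<^sub>R) c ` N)"
    and N: "open N \<and> 0 \<in> N"
  obtain r where r: "r > 0" "\<forall>c\<ge>r. A \<subseteq> (*\<^sub>R) c ` N" using A N by blast
  obtain s where s: "s > 0" "\<forall>c\<ge>s. B \<subseteq> (*\<^sub>R) c ` N" using B N by blast
  have "\<forall>c\<ge>max r s. A \<union> B \<subseteq> (*\<^sub>R) c ` N"
    using r(2) s(2) by simp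
  then show "\<exists>r>0. \<forall>c\<ge>r. A \<union> B \<subseteq> (*\<^sub>R) c ` N"
    using r(1) by (intro exI[of _ "max r s"]) auto
qed

lemma istopology_Lc_open: "istopology Lc_open"
  unfolding istopology_def
proof (intro conjI allI impI)
  fix S S' :: "('a \<Rightarrow> 'b) set"
  assume S: "Lc_open S" and S': "Lc_open S'"
  show "Lc_open (S \<inter> S')"
    unfolding Lc_open_def
  proof (intro conjI ballI)
    show "S \<inter> S' \<subseteq> cont_linear_maps" using S unfolding Lc_open_def by blast
    fix T assume T: "T \<in> S \<inter> S'"
    obtain B N where 1: "tvs_bounded B" "open N" "0 \<in> N"
        "{T' \<in> cont_linear_maps. \<forall>v\<in>B. T' v - T v \<in> N} \<subseteq> S"
      using S T unfolding Lc_open_def by (meson IntD1)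
    obtain B' N' where 2: "tvs_bounded B'" "open N'" "0 \<in> N'"
        "{T' \<in> cont_linear_maps. \<forall>v\<in>B'. T' v - T v \<in> N'} \<subseteq> S'"
      using S' T unfolding Lc_open_def by (meson IntD2)
    show "\<exists>B N. tvs_bounded B \<and> open N \<and> 0 \<in> N \<and>
        {T' \<in> cont_linear_maps. \<forall>v\<in>B. T' v - T v \<in> N} \<subseteq> S \<inter> S'"
      using 1 2
      by (intro exI[of _ "B \<union> B'"] exI[of _ "N \<inter> N'"]) (auto simp: tvs_bounded_Un open_Int)
  qed
next
  fix K :: "('a \<Rightarrow> 'b) set set"
  assume K: "\<forall>S\<in>K. Lc_open S"
  show "Lc_open (\<Union>K)"
    unfolding Lc_open_def
  proof (intro conjI ballI)
    show "\<Union>K \<subseteq> cont_linear_maps" using K unfolding Lc_open_def by blast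
    fix T assume "T \<in> \<Union>K"
    then obtain S where S: "S \<in> K" "T \<in> S" by blast
    then obtain B N where "tvs_bounded B" "open N" "0 \<in> N"
        "{T' \<in> cont_linear_maps. \<forall>v\<in>B. T' v - T v \<in> N} \<subseteq> S"
      using K unfolding Lc_open_def by meson
    then show "\<exists>B N. tvs_bounded B \<and> open N \<and> 0 \<in> N \<and>
        {T' \<in> cont_linear_maps. \<forall>v\<in>B. T' v - T v \<in> N} \<subseteq> \<Union>K"
      using S(1) by blast
  qed
qed

lemma openin_Lc_topology: "openin Lc_topology S \<longleftrightarrow> Lc_open S"
  unfolding Lc_topology_def by (simp add: istopology_Lc_open)

definition C1_F ::
    "'a::topological_real_vector set \<Rightarrow> ('a \<Rightarrow> 'b::{topological_real_vector,t2_space}) \<Rightarrow> bool" where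
  "C1_F U h \<longleftrightarrow> open U \<and> continuous_on U h \<and> has_dir_derivs U h \<and>
     (\<forall>u\<in>U. Dh h u \<in> cont_linear_maps) \<and>
     continuous_map (top_of_set U) Lc_topology (\<lambda>u. Dh h u)"


section \<open>The space of continuous maps on the half-line \<open>(-\<infinity>, 0]\<close>\<close>

text \<open>A continuous map on \<open>(-\<infinity>, 0]\<close> is represented by its extension by \<open>0\<close> to the whole line;
  the extension need not be continuous at \<open>0\<close>.\<close>
typedef (overloaded) 'a hist =
  "{f :: real \<Rightarrow> 'a::real_normed_vector. continuous_on {..0} f \<and> (\<forall>s>0. f s = 0)}"
  morphisms hist_apply Abs_hist
  by (rule exI[of _ "\<lambda>_. 0"]) auto

setup_lifting type_definition_hist

lemma hist_eqI: "(\<And>s. s \<le> 0 \<Longrightarrow> hist_apply \<phi> s = hist_apply \<psi> s) \<Longrightarrow> \<phi> = \<psi>"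
  by transfer (rule ext, metis linorder_not_le)

lemma continuous_on_hist: "continuous_on {..0} (hist_apply \<phi>)"
  using hist_apply[of \<phi>] by simp

instantiation hist :: (real_normed_vector) real_vector
begin

lift_definition zero_hist :: "'a hist" is "\<lambda>_. 0" by simp

lift_definition plus_hist :: "'a hist \<Rightarrow> 'a hist \<Rightarrow> 'a hist" is "\<lambda>f g s. f s + g s"
  by (auto intro: continuous_intros)

lift_definition minus_hist :: "'a hist \<Rightarrow> 'a hist \<Rightarrow> 'a hist" is "\<lambda>f g s. f s - g s"
  by (auto intro: continuous_intros)

lift_definition uminus_hist :: "'a hist \<Rightarrow> 'a hist" is "\<lambda>f s. - f s"
  by (auto intro: continuous_intros)

lift_definition scaleR_hist :: "real \<Rightarrow> 'a hist \<Rightarrow> 'a hist" is "\<lambda>c f s. c *\<^sub>R f s"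
  by (auto intro: continuous_intros)

instance
  by standard (transfer, simp add: algebra_simps fun_eq_iff)+

end

text \<open>Topology of locally uniform convergence: uniform convergence on every \<open>[-T, 0]\<close>.\<close>

definition hist_close :: "real \<Rightarrow> real \<Rightarrow> 'a::real_normed_vector hist \<Rightarrow> 'a hist \<Rightarrow> bool" where
  "hist_close T e \<phi> \<psi> \<longleftrightarrow> (\<forall>s\<in>{-T..0}. dist (hist_apply \<psi> s) (hist_apply \<phi> s) < e)"

lemma hist_close_mono: "hist_close T e \<phi> \<psi> \<Longrightarrow> T' \<le> T \<Longrightarrow> e \<le> e' \<Longrightarrow> hist_close T' e' \<phi> \<psi>"
  unfolding hist_close_def
proof
  fix s
  assume *: "\<forall>s\<in>{- T..0}. dist (hist_apply \<psi> s) (hist_apply \<phi> s) < e" "T' \<le> T" "e \<le> e'"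
    and s: "s \<in> {- T'..0}"
  have "s \<in> {- T..0}" using s *(2) by simp
  then have "dist (hist_apply \<psi> s) (hist_apply \<phi> s) < e" using *(1) by blast
  also note *(3)
  finally show "dist (hist_apply \<psi> s) (hist_apply \<phi> s) < e'" .
qed

instantiation hist :: (real_normed_vector) topological_space
begin

definition open_hist :: "'a hist set \<Rightarrow> bool" where
  "open_hist U \<longleftrightarrow> (\<forall>\<phi>\<in>U. \<exists>T>0. \<exists>e>0. \<forall>\<psi>. hist_close T e \<phi> \<psi> \<longrightarrow> \<psi> \<in> U)"

instance
proof
  show "open (UNIV :: 'a hist set)"
    unfolding open_hist_def using zero_less_one by blast
next
  fix S S' :: "'a hist set"
  assume S: "open S" and S': "open S'"
  show "open (S \<inter> S')"
    unfolding open_hist_def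
  proof
    fix \<phi> assume "\<phi> \<in> S \<inter> S'"
    then have \<phi>: "\<phi> \<in> S" "\<phi> \<in> S'" by auto
    from S \<phi>(1) obtain T e where 1: "T > 0" "e > 0" "\<And>\<psi>. hist_close T e \<phi> \<psi> \<Longrightarrow> \<psi> \<in> S"
      unfolding open_hist_def by blast
    from S' \<phi>(2) obtain T' e' where 2: "T' > 0" "e' > 0" "\<And>\<psi>. hist_close T' e' \<phi> \<psi> \<Longrightarrow> \<psi> \<in> S'"
      unfolding open_hist_def by blast
    have "\<psi> \<in> S \<inter> S'" if "hist_close (max T T') (min e e') \<phi> \<psi>" for \<psi>
    proof
      show "\<psi> \<in> S" by (rule 1(3), rule hist_close_mono[OF that]) simp_all
      show "\<psi> \<in> S'" by (rule 2(3), rule hist_close_mono[OF that]) simp_all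
    qed
    moreover have "max T T' > 0" "min e e' > 0"
      using 1(1,2) 2(1,2) by auto
    ultimately show "\<exists>T>0. \<exists>e>0. \<forall>\<psi>. hist_close T e \<phi> \<psi> \<longrightarrow> \<psi> \<in> S \<inter> S'"
      by blast
  qed
next
  fix K :: "'a hist set set"
  assume K: "\<forall>S\<in>K. open S"
  show "open (\<Union>K)"
    unfolding open_hist_def
  proof
    fix \<phi> assume "\<phi> \<in> \<Union>K"
    then obtain S where S: "S \<in> K" "\<phi> \<in> S" by blast
    then have "open S" using K by blast
    then obtain T e where "T > 0" "e > 0" "\<forall>\<psi>. hist_close T e \<phi> \<psi> \<longrightarrow> \<psi> \<in> S"
      using S(2) unfolding open_hist_def by blast
    then show "\<exists>T>0. \<exists>e>0. \<forall>\<psi>. hist_close T e \<phi> \<psi> \<longrightarrow> \<psi> \<in> \<Union>K"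
      using S(1) by blast
  qed
qed

end

lemma open_hist_close_ball:
  assumes "T > 0" "e > 0"
  shows "open {\<psi>. hist_close T e \<phi> \<psi>}"
  unfolding open_hist_def
proof
  fix \<psi> assume "\<psi> \<in> {\<psi>. hist_close T e \<phi> \<psi>}"
  then have \<psi>: "\<forall>s\<in>{-T..0}. dist (hist_apply \<psi> s) (hist_apply \<phi> s) < e"
    by (simp add: hist_close_def)
  have "continuous_on {-T..0} (\<lambda>s. dist (hist_apply \<psi> s) (hist_apply \<phi> s))"
    by (intro continuous_on_dist continuous_on_subset[OF continuous_on_hist]) auto
  then obtain s0 where s0: "s0 \<in> {-T..0}"
      "\<forall>s\<in>{-T..0}. dist (hist_apply \<psi> s) (hist_apply \<phi> s) \<le> dist (hist_apply \<psi> s0) (hist_apply \<phi> s0)"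
    using continuous_attains_sup[OF compact_Icc, of "-T" 0] assms(1) by force
  define d where "d = e - dist (hist_apply \<psi> s0) (hist_apply \<phi> s0)"
  have "d > 0" using \<psi> s0(1) by (simp add: d_def)
  moreover have "hist_close T e \<phi> \<xi>" if "hist_close T d \<psi> \<xi>" for \<xi>
    unfolding hist_close_def
  proof
    fix s assume s: "s \<in> {-T..0}"
    have "dist (hist_apply \<xi> s) (hist_apply \<phi> s)
        \<le> dist (hist_apply \<xi> s) (hist_apply \<psi> s) + dist (hist_apply \<psi> s) (hist_apply \<phi> s)"
      by (rule dist_triangle)
    also have "\<dots> < d + dist (hist_apply \<psi> s0) (hist_apply \<phi> s0)"
    proof (rule add_less_le_mono)
      show "dist (hist_apply \<xi> s) (hist_apply \<psi> s) < d"
        using that s unfolding hist_close_def by blast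
      show "dist (hist_apply \<psi> s) (hist_apply \<phi> s) \<le> dist (hist_apply \<psi> s0) (hist_apply \<phi> s0)"
        using s0(2) s by blast
    qed
    finally show "dist (hist_apply \<xi> s) (hist_apply \<phi> s) < e" by (simp add: d_def)
  qed
  ultimately show "\<exists>T'>0. \<exists>e'>0. \<forall>\<xi>. hist_close T' e' \<psi> \<xi> \<longrightarrow> \<xi> \<in> {\<psi>. hist_close T e \<phi> \<psi>}"
    using assms(1) by blast
qed

lemma eventually_nhds_hist:
  "eventually P (nhds \<phi>) \<longleftrightarrow> (\<exists>T>0. \<exists>e>0. \<forall>\<psi>. hist_close T e \<phi> \<psi> \<longrightarrow> P \<psi>)"
proof
  assume "eventually P (nhds \<phi>)"
  then obtain S where "open S" "\<phi> \<in> S" "\<forall>\<psi>\<in>S. P \<psi>" by (auto simp: eventually_nhds)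
  then show "\<exists>T>0. \<exists>e>0. \<forall>\<psi>. hist_close T e \<phi> \<psi> \<longrightarrow> P \<psi>"
    unfolding open_hist_def by blast
next
  assume "\<exists>T>0. \<exists>e>0. \<forall>\<psi>. hist_close T e \<phi> \<psi> \<longrightarrow> P \<psi>"
  then obtain T e where T: "T > 0" "e > 0" "\<forall>\<psi>. hist_close T e \<phi> \<psi> \<longrightarrow> P \<psi>" by blast
  show "eventually P (nhds \<phi>)"
    unfolding eventually_nhds
    using T open_hist_close_ball[OF T(1,2)]
    by (intro exI[of _ "{\<psi>. hist_close T e \<phi> \<psi>}"]) (auto simp: hist_close_def)
qed

lemma tendsto_hist_iff:
  "(f \<longlongrightarrow> \<phi>) F \<longleftrightarrow> (\<forall>T>0. \<forall>e>0. eventually (\<lambda>x. hist_close T e \<phi> (f x)) F)"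
proof
  assume f: "(f \<longlongrightarrow> \<phi>) F"
  show "\<forall>T>0. \<forall>e>0. eventually (\<lambda>x. hist_close T e \<phi> (f x)) F"
  proof (intro allI impI)
    fix T e :: real assume "T > 0" "e > 0"
    then have "eventually (hist_close T e \<phi>) (nhds \<phi>)"
      unfolding eventually_nhds_hist by blast
    then show "eventually (\<lambda>x. hist_close T e \<phi> (f x)) F"
      using f unfolding filterlim_iff by blast
  qed
next
  assume *: "\<forall>T>0. \<forall>e>0. eventually (\<lambda>x. hist_close T e \<phi> (f x)) F"
  show "(f \<longlongrightarrow> \<phi>) F"
    unfolding filterlim_iff eventually_nhds_hist
  proof (intro allI impI)
    fix P assume "\<exists>T>0. \<exists>e>0. \<forall>\<psi>. hist_close T e \<phi> \<psi> \<longrightarrow> P \<psi>"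
    then obtain T e where T: "T > 0" "e > 0" "\<And>\<psi>. hist_close T e \<phi> \<psi> \<Longrightarrow> P \<psi>" by blast
    have "eventually (\<lambda>x. hist_close T e \<phi> (f x)) F" using * T(1,2) by blast
    then show "eventually (\<lambda>x. P (f x)) F" by (rule eventually_mono) (rule T(3))
  qed
qed

instance hist :: (real_normed_vector) topological_real_vector
proof
  fix a b :: "'a hist"
  show "((\<lambda>x. fst x + snd x) \<longlongrightarrow> a + b) (nhds a \<times>\<^sub>F nhds b)"
    unfolding tendsto_hist_iff
  proof (intro allI impI)
    fix T e :: real assume T: "T > 0" and e: "e > 0"
    have "eventually (hist_close T (e/2) a) (nhds a)" "eventually (hist_close T (e/2) b) (nhds b)"
      unfolding eventually_nhds_hist using T half_gt_zero[OF e] by blast+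
    then have "\<forall>\<^sub>F x in nhds a \<times>\<^sub>F nhds b. hist_close T (e/2) a (fst x) \<and> hist_close T (e/2) b (snd x)"
      by (rule eventually_prodI[of _ "nhds a" _ "nhds b", THEN eventually_mono]) auto
    then show "\<forall>\<^sub>F x in nhds a \<times>\<^sub>F nhds b. hist_close T e (a + b) (fst x + snd x)"
    proof (rule eventually_mono)
      fix x :: "'a hist \<times> 'a hist"
      assume x: "hist_close T (e/2) a (fst x) \<and> hist_close T (e/2) b (snd x)"
      show "hist_close T e (a + b) (fst x + snd x)"
        unfolding hist_close_def plus_hist.rep_eq
      proof
        fix s assume "s \<in> {-T..0}"
        then have "dist (hist_apply (fst x) s) (hist_apply a s) < e / 2"
          "dist (hist_apply (snd x) s) (hist_apply b s) < e / 2"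
          using x unfolding hist_close_def by blast+
        then show "dist (hist_apply (fst x) s + hist_apply (snd x) s) (hist_apply a s + hist_apply b s) < e"
          by (rule dist_triangle_add_half)
      qed
    qed
  qed
  show "(uminus \<longlongrightarrow> - a) (nhds a)"
    unfolding tendsto_hist_iff
  proof (intro allI impI)
    fix T e :: real assume T: "T > 0" and e: "e > 0"
    have "eventually (hist_close T e a) (nhds a)"
      unfolding eventually_nhds_hist using T e by blast
    then show "\<forall>\<^sub>F x in nhds a. hist_close T e (- a) (- x)"
      by (rule eventually_mono) (auto simp: hist_close_def uminus_hist.rep_eq dist_minus)
  qed
next
  fix c :: real and x :: "'a hist"
  show "((\<lambda>p. fst p *\<^sub>R snd p) \<longlongrightarrow> (c *\<^sub>R x)) (nhds c \<times>\<^sub>F nhds x)"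
    unfolding tendsto_hist_iff
  proof (intro allI impI)
    fix T e :: real assume T: "T > 0" and e: "e > 0"
    have "compact (hist_apply x ` {-T..0})"
      by (intro compact_continuous_image continuous_on_subset[OF continuous_on_hist]) auto
    then obtain M where M: "M > 0" "\<And>s. s \<in> {-T..0} \<Longrightarrow> norm (hist_apply x s) \<le> M"
      by (metis bounded_pos compact_imp_bounded image_eqI)
    define \<delta> where "\<delta> = min 1 (e / (2 * M))"
    define \<eta> where "\<eta> = e / (2 * (\<bar>c\<bar> + 1))"
    have \<delta>: "\<delta> > 0" and \<eta>: "\<eta> > 0" using e M(1) by (auto simp: \<delta>_def \<eta>_def)
    have "\<forall>\<^sub>F k in nhds c. dist k c < \<delta>"
      using \<delta> unfolding eventually_nhds_metric by blast
    moreover have "eventually (hist_close T \<eta> x) (nhds x)"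
      unfolding eventually_nhds_hist using T \<eta> by blast
    ultimately have "\<forall>\<^sub>F p in nhds c \<times>\<^sub>F nhds x. dist (fst p) c < \<delta> \<and> hist_close T \<eta> x (snd p)"
      by (rule eventually_prodI[of _ "nhds c" _ "nhds x", THEN eventually_mono]) auto
    then show "\<forall>\<^sub>F p in nhds c \<times>\<^sub>F nhds x. hist_close T e (c *\<^sub>R x) (fst p *\<^sub>R snd p)"
    proof (rule eventually_mono)
      fix p :: "real \<times> 'a hist"
      assume p: "dist (fst p) c < \<delta> \<and> hist_close T \<eta> x (snd p)"
      obtain k y where ky: "p = (k, y)" by (cases p)
      show "hist_close T e (c *\<^sub>R x) (fst p *\<^sub>R snd p)"
        unfolding hist_close_def scaleR_hist.rep_eq
      proof
        fix s assume s: "s \<in> {-T..0}"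
        let ?y = "hist_apply y s" and ?x = "hist_apply x s"
        have k: "\<bar>k - c\<bar> < \<delta>" using p ky by (simp add: dist_real_def)
        have y: "norm (?y - ?x) < \<eta>" using p ky s by (simp add: hist_close_def dist_norm)
        have "k *\<^sub>R ?y - c *\<^sub>R ?x = k *\<^sub>R (?y - ?x) + (k - c) *\<^sub>R ?x"
          by (simp add: algebra_simps)
        then have "norm (k *\<^sub>R ?y - c *\<^sub>R ?x) \<le> \<bar>k\<bar> * norm (?y - ?x) + \<bar>k - c\<bar> * norm ?x"
          by (metis norm_scaleR norm_triangle_ineq)
        also have "\<dots> < (\<bar>c\<bar> + 1) * \<eta> + \<delta> * M"
        proof (rule add_less_le_mono)
          have "\<bar>k - c\<bar> < 1" using k by (simp add: \<delta>_def)
          then have "\<bar>k\<bar> \<le> \<bar>c\<bar> + 1" by arith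
          then have "\<bar>k\<bar> * norm (?y - ?x) \<le> (\<bar>c\<bar> + 1) * norm (?y - ?x)"
            by (simp add: mult_right_mono)
          also have "\<dots> < (\<bar>c\<bar> + 1) * \<eta>" using y by (intro mult_strict_left_mono) auto
          finally show "\<bar>k\<bar> * norm (?y - ?x) < (\<bar>c\<bar> + 1) * \<eta>" .
          show "\<bar>k - c\<bar> * norm ?x \<le> \<delta> * M"
            using k M(2)[OF s] \<delta> by (intro mult_mono) auto
        qed
        also have "(\<bar>c\<bar> + 1) * \<eta> = e / 2" by (simp add: \<eta>_def field_simps)
        also have "\<delta> * M \<le> (e / (2 * M)) * M"
          using M(1) by (intro mult_right_mono) (auto simp: \<delta>_def)
        also have "(e / (2 * M)) * M = e / 2" using M(1) by simp
        finally show "dist (fst p *\<^sub>R hist_apply (snd p) s) (c *\<^sub>R hist_apply x s) < e"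
          by (simp add: ky dist_norm)
      qed
    qed
  qed
qed

text \<open>The identification \<open>C\<^bsub>n+1\<^esub> = C\<^sub>1 \<times> C\<^sub>n\<close>, with \<open>\<real>\<^bsup>n+1\<^esup>\<close> taken as \<open>\<real> \<times> \<real>\<^sup>n\<close>.\<close>

lift_definition hist_pair ::
    "'a::real_normed_vector hist \<Rightarrow> 'b::real_normed_vector hist \<Rightarrow> ('a \<times> 'b) hist"
  is "\<lambda>f g s. (f s, g s)"
  by (auto intro: continuous_intros simp: zero_prod_def)

lift_definition p_fst :: "('a::real_normed_vector \<times> 'b::real_normed_vector) hist \<Rightarrow> 'a hist"
  is "\<lambda>f s. fst (f s)"
  by (auto intro: continuous_intros)

lift_definition p_n :: "('a::real_normed_vector \<times> 'b::real_normed_vector) hist \<Rightarrow> 'b hist"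
  is "\<lambda>f s. snd (f s)"
  by (auto intro: continuous_intros)

lift_definition shift_star :: "real \<Rightarrow> real hist"
  is "\<lambda>t u. if u \<le> 0 then t + u else 0"
proof -
  fix t :: real
  have "continuous_on {..0} (\<lambda>u. t + u)" by (intro continuous_intros)
  then have "continuous_on {..0} (\<lambda>u. if u \<le> 0 then t + u else 0)"
    by (rule continuous_on_eq) auto
  then show "continuous_on {..0} (\<lambda>u. if u \<le> 0 then t + u else 0) \<and>
      (\<forall>s>0. (if s \<le> 0 then t + s else 0) = 0)" by simp
qed


section \<open>Segments and solutions\<close>

text \<open>\<open>seg x t\<close> is the segment \<open>x\<^sub>t\<close>. It is meaningful only if \<open>x\<close> is continuous on \<open>(-\<infinity>, t]\<close>,
  see \<open>hist_apply_seg\<close>.\<close>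
definition seg :: "(real \<Rightarrow> 'a::real_normed_vector) \<Rightarrow> real \<Rightarrow> 'a hist" where
  "seg x t = Abs_hist (\<lambda>s. if s \<le> 0 then x (t + s) else 0)"

lemma hist_apply_seg:
  assumes "continuous_on {..t} x" "s \<le> 0"
  shows "hist_apply (seg x t) s = x (t + s)"
proof -
  have "continuous_on {..0} (\<lambda>s. x (t + s))"
    by (rule continuous_on_compose2[OF assms(1)]) (auto intro: continuous_intros)
  then have "continuous_on {..0} (\<lambda>s. if s \<le> 0 then x (t + s) else 0)"
    by (rule continuous_on_eq) auto
  then show ?thesis
    unfolding seg_def by (subst Abs_hist_inverse) (use assms(2) in auto)
qed

text \<open>The half-open interval \<open>[t\<^sub>0, t\<^sub>e)\<close>, \<open>t\<^sub>e \<le> \<infinity>\<close>. A map on \<open>(-\<infinity>, 0] + I\<close> is represented by a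
  function on \<^typ>\<open>real\<close> whose values off that set are irrelevant. For \<open>I = [t\<^sub>0, t\<^sub>e)\<close> the set is
  \<open>(-\<infinity>, t\<^sub>e)\<close>.\<close>
definition upto_time :: "real \<Rightarrow> ereal \<Rightarrow> real set" where
  "upto_time t0 te = {t. t0 \<le> t \<and> ereal t < te}"

text \<open>Nonautonomous equation \<open>x'(t) = g(t, x\<^sub>t)\<close>. The condition \<open>(t, x\<^sub>t) \<in> V\<close> comprises
  \<open>x\<^sub>t \<in> C\<^sub>n\<close>, that is, continuity of \<open>x\<close> on \<open>(-\<infinity>, t]\<close>.\<close>
definition solution_on ::
    "(real \<times> 'a::real_normed_vector hist) set \<Rightarrow> (real \<times> 'a hist \<Rightarrow> 'a) \<Rightarrow> real set \<Rightarrow>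
     (real \<Rightarrow> 'a) \<Rightarrow> bool" where
  "solution_on V g I x \<longleftrightarrow> is_interval I \<and>
     (\<forall>t\<in>I. continuous_on {..t} x \<and> (t, seg x t) \<in> V \<and>
        (x has_vector_derivative g (t, seg x t)) (at t within I))"

definition ivp_solution ::
    "(real \<times> 'a::real_normed_vector hist) set \<Rightarrow> (real \<times> 'a hist \<Rightarrow> 'a) \<Rightarrow> real \<Rightarrow> 'a hist \<Rightarrow>
     ereal \<Rightarrow> (real \<Rightarrow> 'a) \<Rightarrow> bool" where
  "ivp_solution V g t0 \<phi> te x \<longleftrightarrow>
     ereal t0 < te \<and> solution_on V g (upto_time t0 te) x \<and> seg x t0 = \<phi>"

text \<open>Autonomous equation \<open>y'(t) = f(y\<^sub>t)\<close>.\<close>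
definition auto_solution_on ::
    "'a::real_normed_vector hist set \<Rightarrow> ('a hist \<Rightarrow> 'a) \<Rightarrow> real set \<Rightarrow> (real \<Rightarrow> 'a) \<Rightarrow> bool" where
  "auto_solution_on U f I y \<longleftrightarrow> is_interval I \<and>
     continuous_on {s + t | s t. s \<le> 0 \<and> t \<in> I} y \<and>
     (\<forall>t\<in>I. seg y t \<in> U \<and> (y has_vector_derivative f (seg y t)) (at t within I))"

definition auto_ivp_solution ::
    "'a::real_normed_vector hist set \<Rightarrow> ('a hist \<Rightarrow> 'a) \<Rightarrow> 'a hist \<Rightarrow> ereal \<Rightarrow>
     (real \<Rightarrow> 'a) \<Rightarrow> bool" where
  "auto_ivp_solution U f \<psi> te y \<longleftrightarrow>
     0 < te \<and> auto_solution_on U f (upto_time 0 te) y \<and> seg y 0 = \<psi>"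

definition auto_maximal_solution ::
    "'a::real_normed_vector hist set \<Rightarrow> ('a hist \<Rightarrow> 'a) \<Rightarrow> 'a hist \<Rightarrow> ereal \<Rightarrow>
     (real \<Rightarrow> 'a) \<Rightarrow> bool" where
  "auto_maximal_solution U f \<psi> te y \<longleftrightarrow> auto_ivp_solution U f \<psi> te y \<and>
     (\<forall>te' y'. auto_ivp_solution U f \<psi> te' y' \<and> te \<le> te' \<and> (\<forall>t. ereal t < te \<longrightarrow> y' t = y t)
        \<longrightarrow> te' = te)"

definition max_time :: "'a::real_normed_vector hist set \<Rightarrow> ('a hist \<Rightarrow> 'a) \<Rightarrow> 'a hist \<Rightarrow> ereal" where
  "max_time U f \<psi> = (THE te. \<exists>y. auto_maximal_solution U f \<psi> te y)"

text \<open>The maximal solution is unique as a map on \<open>(-\<infinity>, t\<^sub>\<psi>)\<close>; its values beyond are arbitrary,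
  so \<open>THE\<close> would not apply here.\<close>
definition max_sol :: "'a::real_normed_vector hist set \<Rightarrow> ('a hist \<Rightarrow> 'a) \<Rightarrow> 'a hist \<Rightarrow> real \<Rightarrow> 'a" where
  "max_sol U f \<psi> = (SOME y. auto_maximal_solution U f \<psi> (max_time U f \<psi>) y)"


section \<open>The solution process\<close>

definition U_g :: "(real \<times> 'a::real_normed_vector hist) set \<Rightarrow> (real \<times> 'a) hist set" where
  "U_g V = {\<psi>. (hist_apply (p_fst \<psi>) 0, p_n \<psi>) \<in> V}"

definition f_g :: "(real \<times> 'a::real_normed_vector hist \<Rightarrow> 'a) \<Rightarrow> (real \<times> 'a) hist \<Rightarrow> real \<times> 'a" where
  "f_g g \<psi> = (1, g (hist_apply (p_fst \<psi>) 0, p_n \<psi>))"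

definition Omega_g ::
    "(real \<times> 'a::real_normed_vector hist) set \<Rightarrow> (real \<times> 'a hist \<Rightarrow> 'a) \<Rightarrow>
     (real \<times> (real \<times> 'a) hist) set" where
  "Omega_g V g = {(t, \<psi>). 0 \<le> t \<and> \<psi> \<in> U_g V \<and> ereal t < max_time (U_g V) (f_g g) \<psi>}"

definition Sigma_g ::
    "(real \<times> 'a::real_normed_vector hist) set \<Rightarrow> (real \<times> 'a hist \<Rightarrow> 'a) \<Rightarrow>
     real \<Rightarrow> (real \<times> 'a) hist \<Rightarrow> (real \<times> 'a) hist" where
  "Sigma_g V g t \<psi> = seg (max_sol (U_g V) (f_g g) \<psi>) t"

definition process_dom ::
    "(real \<times> 'a::real_normed_vector hist) set \<Rightarrow> (real \<times> 'a hist \<Rightarrow> 'a) \<Rightarrow>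
     (real \<times> real \<times> 'a hist) set" where
  "process_dom V g =
     {(t, t0, \<phi>). t0 \<le> t \<and> (t - t0, hist_pair (shift_star t0) \<phi>) \<in> Omega_g V g}"

definition process ::
    "(real \<times> 'a::real_normed_vector hist) set \<Rightarrow> (real \<times> 'a hist \<Rightarrow> 'a) \<Rightarrow>
     real \<Rightarrow> real \<Rightarrow> 'a hist \<Rightarrow> 'a hist" where
  "process V g t t0 \<phi> = p_n (Sigma_g V g (t - t0) (hist_pair (shift_star t0) \<phi>))"

end

theory Submission
  imports Defs
begin

text \<open>Either notion of smoothness bounds \<open>Dg(u)(0, v)\<close> uniformly for \<open>u\<close> close to a given point of \<open>V\<close>
  and \<open>v\<close> close to \<open>0\<close>: for \<open>C\<^sup>1\<^sub>M\<^sub>B\<close> by continuity at \<open>(u, 0)\<close>, for \<open>C\<^sup>1\<^sub>F\<close> because a sequence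
  \<open>v\<^sub>k \<rightarrow> 0\<close> violating such a bound would be a bounded set. By homogeneity and the mean value theorem,
  \<open>g\<close> is locally Lipschitz in its second argument with respect to a seminorm
  \<open>sup\<^bsub>[-T,0]\<^esub> |\<cdot>|\<close>, so Picard iteration yields existence and uniqueness for the nonautonomous initial
  value problem, and its solutions glue to a greatest one. With \<open>\<psi> = (t\<^sub>0\<^sub>*, \<phi>)\<close> the first component
  of a solution of \<open>y'(u) = f\<^sub>g(y\<^sub>u)\<close> is \<open>t\<^sub>0 + u\<close>, hence these solutions are exactly the maps
  \<open>u \<mapsto> (t\<^sub>0 + u, x(t\<^sub>0 + u))\<close> and the maximal ones correspond.\<close>

section \<open>Local Lipschitz estimates from smoothness\<close>

lemma tendsto_dir_quotient:
  assumes "has_dir_derivs U h" "u \<in> U"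
  shows "(dir_quotient h u v \<longlongrightarrow> Dh h u v) (at 0)"
proof -
  obtain d where "(dir_quotient h u v \<longlongrightarrow> d) (at 0)"
    using assms unfolding has_dir_derivs_def by blast
  then show ?thesis
    unfolding Dh_def by (simp add: tendsto_Lim)
qed

text \<open>The quotient of \<open>h\<close> in direction \<open>c v\<close> at step
  \<open>t\<close> is \<open>c\<close> times the quotient in direction \<open>v\<close> at step
  \<open>t * c\<close>, and \<open>t * c\<close> tends to 0 without meeting it. Additivity in the
  direction is not part of \<open>C1_MB\<close>; homogeneity alone carries the scaling arguments
  below for both kinds of smoothness.\<close>

lemma Dh_scaleR:
  assumes "has_dir_derivs U h" "u \<in> U" "c \<noteq> 0"
  shows "Dh h u (c *\<^sub>R v) = c *\<^sub>R Dh h u v"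
proof (rule tendsto_unique)
  show "(dir_quotient h u (c *\<^sub>R v) \<longlongrightarrow> Dh h u (c *\<^sub>R v)) (at 0)"
    using tendsto_dir_quotient assms(1,2) .
  have "filterlim (\<lambda>t. t * c) (at 0) (at 0)"
    unfolding filterlim_at using assms(3)
    by (auto intro!: tendsto_eq_intros simp: eventually_at_filter)
  from filterlim_compose[OF tendsto_dir_quotient[OF assms(1,2)] this]
  have "((\<lambda>t. c *\<^sub>R dir_quotient h u v (t * c)) \<longlongrightarrow> c *\<^sub>R Dh h u v) (at 0)"
    by (intro tendsto_scaleR_tvs tendsto_const)
  also have "(\<lambda>t. c *\<^sub>R dir_quotient h u v (t * c)) = dir_quotient h u (c *\<^sub>R v)"
    using assms(3) by (auto simp: dir_quotient_def fun_eq_iff)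
  finally show "(dir_quotient h u (c *\<^sub>R v) \<longlongrightarrow> c *\<^sub>R Dh h u v) (at 0)" .
qed simp

text \<open>The one-variable difference quotient at \<open>s\<close> is the directional quotient at
  the moved base point \<open>u + s v\<close>. This puts \<open>g\<close> within reach of the mean
  value theorem on line segments.\<close>

lemma has_vector_derivative_along_line:
  fixes h :: "'a::topological_real_vector \<Rightarrow> 'b::real_normed_vector"
  assumes "has_dir_derivs U h" "u + s *\<^sub>R v \<in> U"
  shows "((\<lambda>s. h (u + s *\<^sub>R v)) has_vector_derivative Dh h (u + s *\<^sub>R v) v) (at s)"
proof -
  have "(\<lambda>t. (1 / t) *\<^sub>R (h (u + (s + t) *\<^sub>R v) - h (u + s *\<^sub>R v))) = dir_quotient h (u + s *\<^sub>R v) v"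
    by (simp add: dir_quotient_def fun_eq_iff algebra_simps)
  then have "((\<lambda>t. (1 / t) *\<^sub>R (h (u + (s + t) *\<^sub>R v) - h (u + s *\<^sub>R v))) \<longlongrightarrow> Dh h (u + s *\<^sub>R v) v) (at 0)"
    using tendsto_dir_quotient[OF assms] by simp
  then have "((\<lambda>t. norm ((1 / t) *\<^sub>R (h (u + (s + t) *\<^sub>R v) - h (u + s *\<^sub>R v)) - Dh h (u + s *\<^sub>R v) v)) \<longlongrightarrow> 0) (at 0)"
    by (simp add: LIM_zero_iff tendsto_norm_zero_iff)
  then have "((\<lambda>t. norm (h (u + (s + t) *\<^sub>R v) - h (u + s *\<^sub>R v) - t *\<^sub>R Dh h (u + s *\<^sub>R v) v) / norm t) \<longlongrightarrow> 0) (at 0)"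
  proof (rule Lim_transform_eventually)
    have "norm ((1 / t) *\<^sub>R (h (u + (s + t) *\<^sub>R v) - h (u + s *\<^sub>R v)) - Dh h (u + s *\<^sub>R v) v)
        = norm (h (u + (s + t) *\<^sub>R v) - h (u + s *\<^sub>R v) - t *\<^sub>R Dh h (u + s *\<^sub>R v) v) / norm t"
      if "t \<noteq> 0" for t
    proof -
      have "(1 / t) *\<^sub>R (h (u + (s + t) *\<^sub>R v) - h (u + s *\<^sub>R v)) - Dh h (u + s *\<^sub>R v) v
        = (1 / t) *\<^sub>R (h (u + (s + t) *\<^sub>R v) - h (u + s *\<^sub>R v) - t *\<^sub>R Dh h (u + s *\<^sub>R v) v)"
        using that by (simp add: scaleR_diff_right)
      then show ?thesis by simp
    qed
    then show "\<forall>\<^sub>F t in at 0. norm ((1 / t) *\<^sub>R (h (u + (s + t) *\<^sub>R v) - h (u + s *\<^sub>R v)) - Dh h (u + s *\<^sub>R v) v)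
        = norm (h (u + (s + t) *\<^sub>R v) - h (u + s *\<^sub>R v) - t *\<^sub>R Dh h (u + s *\<^sub>R v) v) / norm t"
      by (auto simp: eventually_at_filter)
  qed
  then show ?thesis
    unfolding has_vector_derivative_def has_derivative_at
    by (auto intro: bounded_linear_scaleR_left)
qed

section \<open>Seminorm neighbourhoods, local bounds on the derivative, and the resulting Lipschitz
  estimates\<close>

lemma open_prod_hist_nhd:
  fixes V :: "(real \<times> 'a::real_normed_vector hist) set"
  assumes "open V" "(t0, \<phi>) \<in> V"
  obtains T e where "T > 0" "e > 0"
    "\<And>t \<psi>. \<bar>t - t0\<bar> < e \<Longrightarrow> hist_close T e \<phi> \<psi> \<Longrightarrow> (t, \<psi>) \<in> V"
proof -
  obtain A B where AB: "open A" "open B" "(t0, \<phi>) \<in> A \<times> B" "A \<times> B \<subseteq> V"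
    using assms by (rule open_prod_elim)
  obtain d where d: "d > 0" "\<And>t. dist t t0 < d \<Longrightarrow> t \<in> A"
    using AB(1,3) unfolding open_dist by blast
  obtain T e where T: "T > 0" "e > 0" "\<And>\<psi>. hist_close T e \<phi> \<psi> \<Longrightarrow> \<psi> \<in> B"
    using AB(2,3) unfolding open_hist_def by blast
  show ?thesis
  proof (rule that[of T "min d e"])
    fix t \<psi>
    assume *: "\<bar>t - t0\<bar> < min d e" "hist_close T (min d e) \<phi> \<psi>"
    have "t \<in> A" using d(2) *(1) by (simp add: dist_real_def)
    moreover have "\<psi> \<in> B" using T(3) hist_close_mono[OF *(2)] by simp
    ultimately show "(t, \<psi>) \<in> V" using AB(4) by blast
  qed (use d T in auto)
qed

lemma hist_close_refl: "e > 0 \<Longrightarrow> hist_close T e \<phi> \<phi>"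
  by (simp add: hist_close_def)

lemma hist_bounded:
  fixes v :: "'a::real_normed_vector hist"
  obtains M where "M > 0" "\<And>s. s \<in> {-T..0} \<Longrightarrow> norm (hist_apply v s) \<le> M"
proof -
  have "compact (hist_apply v ` {-T..0})"
    by (intro compact_continuous_image continuous_on_subset[OF continuous_on_hist]) auto
  then show ?thesis
    using that by (metis bounded_pos compact_imp_bounded image_eqI)
qed

text \<open>The common consequence of the two kinds of smoothness. Directions have time component 0
  because the Lipschitz estimate is needed in the history argument only. The bound 1 is a
  normalisation: by homogeneity any other positive bound is reached by rescaling the neighbourhood
  of directions.\<close>

definition Dh_locally_bounded ::
    "(real \<times> 'a::real_normed_vector hist) set \<Rightarrow> (real \<times> 'a hist \<Rightarrow> 'b::real_normed_vector) \<Rightarrow> bool" where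
  "Dh_locally_bounded V g \<longleftrightarrow>
   (\<forall>t0 \<phi>. (t0, \<phi>) \<in> V \<longrightarrow> (\<exists>T>0. \<exists>e>0. \<forall>t \<psi> v. \<bar>t - t0\<bar> < e \<longrightarrow> hist_close T e \<phi> \<psi> \<longrightarrow>
      hist_close T e 0 v \<longrightarrow> (t, \<psi>) \<in> V \<and> norm (Dh g (t, \<psi>) (0, v)) \<le> 1))"

lemma C1_MB_imp_Dh_locally_bounded:
  fixes g :: "real \<times> 'a::real_normed_vector hist \<Rightarrow> 'b::real_normed_vector"
  assumes "C1_MB V g"
  shows "Dh_locally_bounded V g"
  unfolding Dh_locally_bounded_def
proof (intro allI impI)
  fix t0 and \<phi> :: "'a hist" assume V: "(t0, \<phi>) \<in> V"
  let ?D = "\<lambda>(u, v). Dh g u v"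
  have op: "open V" and der: "has_dir_derivs V g" and cont: "continuous_on (V \<times> UNIV) ?D"
    using assms by (auto simp: C1_MB_def)
  \<comment> \<open>Homogeneity with factor 2 gives \<open>D 0 = D (2 0) = 2 D 0\<close>, so the
    derivative vanishes in direction 0 without any linearity.\<close>
  have z: "Dh g (t0, \<phi>) 0 = 0"
    using Dh_scaleR[OF der V, of 2 0] by (simp add: scaleR_2)
  have "open (V \<times> (UNIV :: (real \<times> 'a hist) set))" using op by (simp add: open_Times)
  then have "open (?D -` ball 0 1 \<inter> (V \<times> UNIV))"
    using cont by (simp add: continuous_on_open_vimage)
  moreover have "((t0, \<phi>), 0) \<in> ?D -` ball 0 1 \<inter> (V \<times> UNIV)"
    using V z by simp
  ultimately obtain A B where AB: "open A" "open B" "((t0, \<phi>), 0) \<in> A \<times> B"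
      "A \<times> B \<subseteq> ?D -` ball 0 1 \<inter> (V \<times> UNIV)"
    by (rule open_prod_elim)
  obtain T1 e1 where 1: "T1 > 0" "e1 > 0"
    "\<And>t \<psi>. \<bar>t - t0\<bar> < e1 \<Longrightarrow> hist_close T1 e1 \<phi> \<psi> \<Longrightarrow> (t, \<psi>) \<in> A"
    using open_prod_hist_nhd[of A t0 \<phi>] AB by blast
  have B0: "(0::real, 0::'a hist) \<in> B" using AB(3) by (simp add: zero_prod_def)
  obtain T2 e2 where 2: "T2 > 0" "e2 > 0"
    "\<And>t \<psi>. \<bar>t - 0\<bar> < e2 \<Longrightarrow> hist_close T2 e2 0 \<psi> \<Longrightarrow> (t, \<psi>) \<in> B"
    using open_prod_hist_nhd[OF AB(2) B0] by blast
  show "\<exists>T>0. \<exists>e>0. \<forall>t \<psi> v. \<bar>t - t0\<bar> < e \<longrightarrow> hist_close T e \<phi> \<psi> \<longrightarrow>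
      hist_close T e 0 v \<longrightarrow> (t, \<psi>) \<in> V \<and> norm (Dh g (t, \<psi>) (0, v)) \<le> 1"
  proof (rule exI[of _ "max T1 T2"], rule conjI[rotated], rule exI[of _ "min e1 e2"], intro conjI allI impI)
    fix t \<psi> and v :: "'a hist"
    assume *: "\<bar>t - t0\<bar> < min e1 e2" "hist_close (max T1 T2) (min e1 e2) \<phi> \<psi>"
      "hist_close (max T1 T2) (min e1 e2) 0 v"
    have "(t, \<psi>) \<in> A" using * by (intro 1(3)) (auto intro: hist_close_mono)
    moreover have "(0, v) \<in> B" using * 2(2) by (intro 2(3)) (auto intro: hist_close_mono)
    ultimately have **: "((t, \<psi>), (0, v)) \<in> ?D -` ball 0 1 \<inter> (V \<times> UNIV)" using AB(4) by blast
    then show "(t, \<psi>) \<in> V" "norm (Dh g (t, \<psi>) (0, v)) \<le> 1" by auto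
  qed (use 1 2 in auto)
qed

text \<open>A neighbourhood of 0 looks only at some interval \<open>[-T, 0]\<close>. On it all
  \<open>v k\<close> with \<open>k\<close> beyond \<open>T\<close> are below 1, and the finitely
  many others are bounded by compactness, so one constant bounds the whole sequence.\<close>

lemma tvs_bounded_null_sequence:
  fixes v :: "nat \<Rightarrow> 'a::real_normed_vector hist"
  assumes "\<And>k. hist_close (Suc k) (1 / Suc k) 0 (v k)"
  shows "tvs_bounded (range (\<lambda>k. (0::real, v k)))"
  unfolding tvs_bounded_def
proof (intro allI impI)
  fix N :: "(real \<times> 'a hist) set"
  assume N: "open N \<and> 0 \<in> N"
  then have N0: "open N" "(0, 0) \<in> N" by (auto simp: zero_prod_def)
  obtain T e where T: "T > 0" "e > 0"
    "\<And>t \<psi>. \<bar>t - 0\<bar> < e \<Longrightarrow> hist_close T e 0 \<psi> \<Longrightarrow> (t, \<psi>) \<in> N"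
    using open_prod_hist_nhd[OF N0] by blast
  obtain K :: nat where K: "T < K" by (metis reals_Archimedean2)
  have "\<forall>k. \<exists>M>0. \<forall>s\<in>{-T..0}. norm (hist_apply (v k) s) \<le> M"
    using hist_bounded by metis
  then obtain M where M: "\<And>k. M k > 0" "\<And>k s. s \<in> {-T..0} \<Longrightarrow> norm (hist_apply (v k) s) \<le> M k"
    by metis
  \<comment> \<open>The sum dominates each of the finitely many early bounds, and the summand 1
    covers the tail.\<close>
  define R where "R = 1 + (\<Sum>k<K. M k)"
  have "(\<Sum>k<K. M k) \<ge> 0" using M(1) by (simp add: sum_nonneg less_imp_le)
  then have R: "R \<ge> 1" by (simp add: R_def)
  have bd: "norm (hist_apply (v k) s) \<le> R" if "s \<in> {-T..0}" for k s
  proof (cases "k < K")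
    case True
    then have "M k \<le> (\<Sum>k<K. M k)" using M(1) by (intro member_le_sum) (auto simp: less_imp_le)
    then show ?thesis using M(2)[OF that, of k] by (simp add: R_def)
  next
    case False
    then have "s \<in> {-real (Suc k)..0}" using that K by auto
    then have "norm (hist_apply (v k) s) < 1 / Suc k"
      using assms[of k] by (auto simp: hist_close_def zero_hist.rep_eq)
    also have "\<dots> \<le> 1" by simp
    also note R
    finally show ?thesis by simp
  qed
  \<comment> \<open>The factor 2 in the threshold \<open>2 * R / e\<close> turns the weak bound
    \<open>R\<close> into the strict one that \<open>hist_close\<close> demands after division by
    \<open>c\<close>.\<close>
  show "\<exists>r>0. \<forall>c\<ge>r. range (\<lambda>k. (0::real, v k)) \<subseteq> (*\<^sub>R) c ` N"
  proof (intro exI[of _ "2 * R / e"] conjI allI impI subsetI)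
    show pos: "2 * R / e > 0" using R T by simp
    fix c p assume c: "2 * R / e \<le> c" and "p \<in> range (\<lambda>k. (0::real, v k))"
    then obtain k where p: "p = (0, v k)" by blast
    have c0: "c > 0" using c pos by linarith
    have "hist_close T e 0 ((1/c) *\<^sub>R v k)"
      unfolding hist_close_def
    proof
      fix s assume s: "s \<in> {-T..0}"
      have "norm (hist_apply (v k) s) \<le> R" using bd s by blast
      also have "R < 2 * R" using R by simp
      also have "2 * R \<le> e * c" using c T by (simp add: field_simps)
      finally show "dist (hist_apply ((1/c) *\<^sub>R v k) s) (hist_apply 0 s) < e"
        using c0 by (simp add: zero_hist.rep_eq scaleR_hist.rep_eq field_simps)
    qed
    then have "(0, (1/c) *\<^sub>R v k) \<in> N" using T by (intro T(3)) auto
    moreover have "p = c *\<^sub>R (0, (1/c) *\<^sub>R v k)" using p c0 by simp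
    ultimately show "p \<in> (*\<^sub>R) c ` N" by blast
  qed
qed

text \<open>The pointwise condition \<open>norm (T' v - T v) < c\<close> on \<open>B\<close> need not define an open set, as the
  supremum over \<open>B\<close> may be \<open>c\<close> without being attained; hence the uniform bound \<open>r < c\<close>.\<close>
lemma Lc_open_uniform_nhd:
  fixes T :: "'a::topological_real_vector \<Rightarrow> 'b::real_normed_vector"
  assumes "tvs_bounded B"
  shows "Lc_open {T' \<in> cont_linear_maps. \<exists>r<c. \<forall>v\<in>B. norm (T' v - T v) \<le> r}"
  unfolding Lc_open_def
proof (intro conjI ballI)
  fix T' assume "T' \<in> {T' \<in> cont_linear_maps. \<exists>r<c. \<forall>v\<in>B. norm (T' v - T v) \<le> r}"
  then obtain r where r: "r < c" "\<And>v. v \<in> B \<Longrightarrow> norm (T' v - T v) \<le> r" by auto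
  define d where "d = (c - r) / 2"
  have "{T'' \<in> cont_linear_maps. \<forall>v\<in>B. T'' v - T' v \<in> ball 0 d}
      \<subseteq> {T' \<in> cont_linear_maps. \<exists>r<c. \<forall>v\<in>B. norm (T' v - T v) \<le> r}"
  proof safe
    fix T'' assume *: "\<forall>v\<in>B. T'' v - T' v \<in> ball 0 d"
    have "norm (T'' v - T v) \<le> r + d" if "v \<in> B" for v
      using norm_triangle_ineq[of "T'' v - T' v" "T' v - T v"] * r(2) that by fastforce
    moreover have "r + d < c" using r(1) by (simp add: d_def field_simps)
    ultimately show "\<exists>r<c. \<forall>v\<in>B. norm (T'' v - T v) \<le> r" by blast
  qed
  moreover have "open (ball (0 :: 'b) d)" "(0 :: 'b) \<in> ball 0 d"
    using r(1) by (auto simp: d_def)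
  ultimately show "\<exists>A N. tvs_bounded A \<and> open N \<and> 0 \<in> N \<and> {T'' \<in> cont_linear_maps. \<forall>v\<in>A. T'' v - T' v \<in> N}
      \<subseteq> {T' \<in> cont_linear_maps. \<exists>r<c. \<forall>v\<in>B. norm (T' v - T v) \<le> r}"
    using assms by blast
qed auto

text \<open>Joint continuity of the derivative is not at hand, only uniform closeness on bounded
  sets. Directions violating the bound would form a null sequence, hence a bounded set. On this set
  \<open>Dh g\<close> near the base point differs little from \<open>Dh g (t0, \<phi>)\<close>,
  which is itself small near 0 by continuity.\<close>

lemma C1_F_imp_Dh_locally_bounded:
  fixes g :: "real \<times> 'a::real_normed_vector hist \<Rightarrow> 'b::real_normed_vector"
  assumes "C1_F V g"
  shows "Dh_locally_bounded V g"
  unfolding Dh_locally_bounded_def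
proof (intro allI impI)
  fix t0 and \<phi> :: "'a hist" assume V: "(t0, \<phi>) \<in> V"
  have op: "open V"
    and lin: "\<And>u. u \<in> V \<Longrightarrow> Dh g u \<in> cont_linear_maps"
    and cont: "continuous_map (top_of_set V) Lc_topology (\<lambda>u. Dh g u)"
    using assms by (auto simp: C1_F_def)
  obtain T0 e0 where 0: "T0 > 0" "e0 > 0"
    "\<And>t \<psi>. \<bar>t - t0\<bar> < e0 \<Longrightarrow> hist_close T0 e0 \<phi> \<psi> \<Longrightarrow> (t, \<psi>) \<in> V"
    using open_prod_hist_nhd[OF op V] by blast
  show "\<exists>T>0. \<exists>e>0. \<forall>t \<psi> v. \<bar>t - t0\<bar> < e \<longrightarrow> hist_close T e \<phi> \<psi> \<longrightarrow>
      hist_close T e 0 v \<longrightarrow> (t, \<psi>) \<in> V \<and> norm (Dh g (t, \<psi>) (0, v)) \<le> 1" (is "?P")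
  proof (rule ccontr)
    assume "\<not> ?P"
    then have neg: "\<exists>t \<psi> v. \<bar>t - t0\<bar> < e \<and> hist_close T e \<phi> \<psi> \<and> hist_close T e 0 v \<and>
        \<not> ((t, \<psi>) \<in> V \<and> norm (Dh g (t, \<psi>) (0, v)) \<le> 1)" if "T > 0" "e > 0" for T e
      using that by meson
    \<comment> \<open>Growing intervals \<open>Suc k\<close> and shrinking radii
      \<open>1 / Suc k\<close> make the base points converge to \<open>(t0, \<phi>)\<close> and the
      directions to 0.\<close>
    have "\<forall>k. \<exists>t \<psi> v. \<bar>t - t0\<bar> < 1 / Suc k \<and> hist_close (Suc k) (1 / Suc k) \<phi> \<psi> \<and>
        hist_close (Suc k) (1 / Suc k) 0 v \<and> \<not> ((t, \<psi>) \<in> V \<and> norm (Dh g (t, \<psi>) (0, v)) \<le> 1)"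
      by (intro allI neg) auto
    then obtain t \<psi> v where seq: "\<And>k. \<bar>t k - t0\<bar> < 1 / Suc k"
      "\<And>k. hist_close (Suc k) (1 / Suc k) \<phi> (\<psi> k)"
      "\<And>k. hist_close (Suc k) (1 / Suc k) 0 (v k)"
      "\<And>k. \<not> ((t k, \<psi> k) \<in> V \<and> norm (Dh g (t k, \<psi> k) (0, v k)) \<le> 1)"
      by metis
    have large: "\<exists>K. \<forall>k\<ge>K. T \<le> real (Suc k) \<and> 1 / Suc k \<le> e" if "e > 0" for T e :: real
    proof -
      obtain K :: nat where K: "max T (1 / e) < K" by (metis reals_Archimedean2)
      have "T \<le> real (Suc k) \<and> 1 / Suc k \<le> e" if "k \<ge> K" for k
      proof -
        have "T < real (Suc k)" "1 / e < real (Suc k)" using K that by auto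
        then show ?thesis using \<open>e > 0\<close> by (simp add: field_simps)
      qed
      then show ?thesis by blast
    qed
    define B where "B = range (\<lambda>k. (0::real, v k))"
    \<comment> \<open>The bound 1 to be contradicted is split as 1/2 for the distance to the
      derivative at \<open>(t0, \<phi>)\<close> and 1/2 for that derivative itself.\<close>
    define W where "W = {T' \<in> cont_linear_maps. \<exists>r<1/2. \<forall>v\<in>B. norm (T' v - Dh g (t0, \<phi>) v) \<le> r}"
    have "openin Lc_topology W"
      unfolding openin_Lc_topology W_def B_def
      by (intro Lc_open_uniform_nhd tvs_bounded_null_sequence seq(3))
    then have "openin (top_of_set V) {u \<in> topspace (top_of_set V). Dh g u \<in> W}"
      using cont by (rule openin_continuous_map_preimage[rotated])
    then have opW: "open {u \<in> V. Dh g u \<in> W}"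
      using op by (simp add: openin_open_eq)
    moreover have "(t0, \<phi>) \<in> {u \<in> V. Dh g u \<in> W}"
      using V lin[OF V] by (auto simp: W_def intro!: exI[of _ 0])
    ultimately obtain T1 e1 where 1: "T1 > 0" "e1 > 0"
      "\<And>t \<psi>. \<bar>t - t0\<bar> < e1 \<Longrightarrow> hist_close T1 e1 \<phi> \<psi> \<Longrightarrow> (t, \<psi>) \<in> {u \<in> V. Dh g u \<in> W}"
      using open_prod_hist_nhd[of "{u \<in> V. Dh g u \<in> W}" t0 \<phi>] by blast
    have "continuous_on UNIV (Dh g (t0, \<phi>))" and l0: "linear (Dh g (t0, \<phi>))"
      using lin[OF V] by (auto simp: cont_linear_maps_def)
    then have "open (Dh g (t0, \<phi>) -` ball 0 (1/2))"
      by (simp add: open_vimage)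
    moreover have "(0, 0) \<in> Dh g (t0, \<phi>) -` ball 0 (1/2)"
      using linear_0[OF l0] by (simp add: zero_prod_def)
    ultimately obtain T2 e2 where 2: "T2 > 0" "e2 > 0"
      "\<And>t \<psi>. \<bar>t - 0\<bar> < e2 \<Longrightarrow> hist_close T2 e2 0 \<psi> \<Longrightarrow> (t, \<psi>) \<in> Dh g (t0, \<phi>) -` ball 0 (1/2)"
      using open_prod_hist_nhd[of "Dh g (t0, \<phi>) -` ball 0 (1/2)" 0 0] by blast
    obtain k where k: "max T1 T2 \<le> real (Suc k)" "1 / Suc k \<le> min e1 e2"
      using large[of "min e1 e2" "max T1 T2"] 1 2 by auto
    have "(t k, \<psi> k) \<in> {u \<in> V. Dh g u \<in> W}"
      using seq(1,2)[of k] k by (intro 1(3)) (auto intro: hist_close_mono)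
    then have kV: "(t k, \<psi> k) \<in> V" and "Dh g (t k, \<psi> k) \<in> W" by auto
    then obtain r where "r < 1 / 2" "\<forall>v\<in>B. norm (Dh g (t k, \<psi> k) v - Dh g (t0, \<phi>) v) \<le> r"
      unfolding W_def by blast
    moreover have "(0, v k) \<in> B" by (simp add: B_def)
    ultimately have "norm (Dh g (t k, \<psi> k) (0, v k) - Dh g (t0, \<phi>) (0, v k)) < 1 / 2"
      by (meson le_less_trans)
    moreover have "(0, v k) \<in> Dh g (t0, \<phi>) -` ball 0 (1/2)"
      using seq(3)[of k] k 2 by (intro 2(3)) (auto intro: hist_close_mono)
    then have "norm (Dh g (t0, \<phi>) (0, v k)) < 1 / 2" by simp
    ultimately have "norm (Dh g (t k, \<psi> k) (0, v k)) \<le> 1"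
      using norm_triangle_ineq[of "Dh g (t k, \<psi> k) (0, v k) - Dh g (t0, \<phi>) (0, v k)" "Dh g (t0, \<phi>) (0, v k)"]
      by simp
    then show False using seq(4) kV by blast
  qed
qed

text \<open>\<open>M\<close> stands for any bound of the seminorm of \<open>\<psi> - \<xi>\<close>
  over \<open>[-T, 0]\<close>, which avoids naming a supremum. The case \<open>M = 0\<close> shows
  that \<open>g\<close> locally depends only on the history over \<open>[-T, 0]\<close>.\<close>

definition lipschitz_hist ::
    "(real \<times> 'a::real_normed_vector hist) set \<Rightarrow> (real \<times> 'a hist \<Rightarrow> 'b::real_normed_vector) \<Rightarrow>
     real \<Rightarrow> 'a hist \<Rightarrow> real \<Rightarrow> real \<Rightarrow> real \<Rightarrow> bool" where
  "lipschitz_hist V g t0 \<phi> T e L \<longleftrightarrow>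
     (\<forall>t \<psi> \<xi> M. \<bar>t - t0\<bar> < e \<longrightarrow> hist_close T e \<phi> \<psi> \<longrightarrow> hist_close T e \<phi> \<xi> \<longrightarrow>
        (t, \<psi>) \<in> V \<and>
        ((\<forall>s\<in>{-T..0}. norm (hist_apply \<psi> s - hist_apply \<xi> s) \<le> M) \<longrightarrow>
           norm (g (t, \<psi>) - g (t, \<xi>)) \<le> L * M))"

text \<open>Keeps the line segment from \<open>\<xi>\<close> to \<open>\<psi>\<close> inside the
  neighbourhood where the derivative is bounded.\<close>

lemma hist_close_convex:
  assumes "hist_close T e \<phi> \<psi>" "hist_close T e \<phi> \<xi>" "0 \<le> r" "r \<le> 1"
  shows "hist_close T e \<phi> (\<xi> + r *\<^sub>R (\<psi> - \<xi>))"
  unfolding hist_close_def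
proof
  fix s assume s: "s \<in> {-T..0}"
  have "convex (ball (hist_apply \<phi> s) e)" by simp
  moreover have "hist_apply \<psi> s \<in> ball (hist_apply \<phi> s) e" "hist_apply \<xi> s \<in> ball (hist_apply \<phi> s) e"
    using assms s by (auto simp: hist_close_def dist_commute)
  ultimately have "(1 - r) *\<^sub>R hist_apply \<xi> s + r *\<^sub>R hist_apply \<psi> s \<in> ball (hist_apply \<phi> s) e"
    using assms(3,4) by (simp add: convex_def)
  moreover have "(1 - r) *\<^sub>R hist_apply \<xi> s + r *\<^sub>R hist_apply \<psi> s = hist_apply (\<xi> + r *\<^sub>R (\<psi> - \<xi>)) s"
    by (simp add: plus_hist.rep_eq scaleR_hist.rep_eq minus_hist.rep_eq algebra_simps)
  ultimately show "dist (hist_apply (\<xi> + r *\<^sub>R (\<psi> - \<xi>)) s) (hist_apply \<phi> s) < e"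
    by (simp add: dist_commute)
qed

lemma onorm_real_scaleR_le:
  fixes d :: "'a::real_normed_vector"
  assumes "norm d \<le> B"
  shows "onorm (\<lambda>h::real. h *\<^sub>R d) \<le> B"
  by (rule onorm_le) (simp add: mult.commute[of B] mult_left_mono assms)

text \<open>A direction of seminorm at most \<open>M\<close> can be scaled to seminorm just below
  \<open>e\<close>, where the derivative is at most 1; homogeneity then bounds it by
  \<open>M / e\<close>. The mean value theorem along the segment from \<open>\<xi>\<close> to
  \<open>\<psi>\<close> gives the Lipschitz constant \<open>1 / e\<close>.\<close>

lemma Dh_locally_bounded_imp_lipschitz:
  fixes g :: "real \<times> 'a::real_normed_vector hist \<Rightarrow> 'b::real_normed_vector"
  assumes bounded: "Dh_locally_bounded V g" and der: "has_dir_derivs V g" and V: "(t0, \<phi>) \<in> V"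
  shows "\<exists>T>0. \<exists>e>0. \<exists>L\<ge>0. lipschitz_hist V g t0 \<phi> T e L"
proof -
  obtain T e where Te: "T > 0" "e > 0"
    "\<And>t \<psi> v. \<bar>t - t0\<bar> < e \<Longrightarrow> hist_close T e \<phi> \<psi> \<Longrightarrow> hist_close T e 0 v \<Longrightarrow>
        (t, \<psi>) \<in> V \<and> norm (Dh g (t, \<psi>) (0, v)) \<le> 1"
    using bounded V unfolding Dh_locally_bounded_def by meson
  have dom: "(t, \<psi>) \<in> V" if "\<bar>t - t0\<bar> < e" "hist_close T e \<phi> \<psi>" for t \<psi>
  proof -
    have "hist_close T e (0 :: 'a hist) 0" using Te(2) by (rule hist_close_refl)
    then show ?thesis using Te(3) that by blast
  qed
  have Dh_le: "norm (Dh g (t, \<psi>) (0, w)) \<le> M / e"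
    if t: "\<bar>t - t0\<bar> < e" and \<psi>: "hist_close T e \<phi> \<psi>"
      and w: "\<And>s. s \<in> {-T..0} \<Longrightarrow> norm (hist_apply w s) \<le> M" for t \<psi> w M
  proof (rule field_le_epsilon)
    have M: "M \<ge> 0" using order_trans[OF norm_ge_zero w[of 0]] Te(1) by simp
    fix d :: real assume d: "d > 0"
    define c where "c = e / (M + d * e)"
    have pos: "M + d * e > 0" using M d Te(2) by (simp add: add_nonneg_pos)
    then have c: "c > 0" using Te(2) by (simp add: c_def)
    have "hist_close T e 0 (c *\<^sub>R w)"
      unfolding hist_close_def
    proof
      fix s assume "s \<in> {-T..0}"
      then have "c * norm (hist_apply w s) \<le> c * M" using w c by simp
      also have "\<dots> < c * (M + d * e)" using c d Te(2) by simp
      also have "\<dots> = e" using pos by (simp add: c_def)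
      finally show "dist (hist_apply (c *\<^sub>R w) s) (hist_apply 0 s) < e"
        using c by (simp add: zero_hist.rep_eq scaleR_hist.rep_eq)
    qed
    then have *: "(t, \<psi>) \<in> V" "norm (Dh g (t, \<psi>) (0, c *\<^sub>R w)) \<le> 1"
      using Te(3) t \<psi> by blast+
    have "Dh g (t, \<psi>) (0, c *\<^sub>R w) = c *\<^sub>R Dh g (t, \<psi>) (0, w)"
      using Dh_scaleR[OF der *(1), of c "(0, w)"] c by simp
    then have "c * norm (Dh g (t, \<psi>) (0, w)) \<le> 1" using * c by simp
    then have "norm (Dh g (t, \<psi>) (0, w)) \<le> 1 / c" using c by (simp add: field_simps)
    also have "1 / c = M / e + d" using Te(2) by (simp add: c_def add_divide_distrib)
    finally show "norm (Dh g (t, \<psi>) (0, w)) \<le> M / e + d" .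
  qed
  have "lipschitz_hist V g t0 \<phi> T e (1 / e)"
    unfolding lipschitz_hist_def
  proof (intro allI impI conjI)
    fix t \<psi> \<xi> M
    assume t: "\<bar>t - t0\<bar> < e" and \<psi>: "hist_close T e \<phi> \<psi>" and \<xi>: "hist_close T e \<phi> \<xi>"
    show "(t, \<psi>) \<in> V" using dom t \<psi> by blast
    assume M: "\<forall>s\<in>{-T..0}. norm (hist_apply \<psi> s - hist_apply \<xi> s) \<le> M"
    let ?w = "\<psi> - \<xi>"
    let ?f = "\<lambda>r. g ((t, \<xi>) + r *\<^sub>R (0, ?w))"
    have "norm (?f 1 - ?f 0) \<le> M / e * norm (1 - 0 :: real)"
    proof (rule differentiable_bound[where S = "{0..1}" and f' = "\<lambda>r h. h *\<^sub>R Dh g ((t, \<xi>) + r *\<^sub>R (0, ?w)) (0, ?w)"])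
      fix r :: real assume "r \<in> {0..1}"
      then have r: "hist_close T e \<phi> (\<xi> + r *\<^sub>R ?w)"
        using hist_close_convex[OF \<psi> \<xi>] by simp
      then have "(t, \<xi>) + r *\<^sub>R (0, ?w) \<in> V" using dom t by simp
      from has_vector_derivative_along_line[OF der this]
      show "(?f has_derivative (\<lambda>h. h *\<^sub>R Dh g ((t, \<xi>) + r *\<^sub>R (0, ?w)) (0, ?w))) (at r within {0..1})"
        unfolding has_vector_derivative_def by (rule has_derivative_at_withinI)
      have "norm (Dh g (t, \<xi> + r *\<^sub>R ?w) (0, ?w)) \<le> M / e"
        using M by (intro Dh_le t r) (auto simp: minus_hist.rep_eq)
      then show "onorm (\<lambda>h. h *\<^sub>R Dh g ((t, \<xi>) + r *\<^sub>R (0, ?w)) (0, ?w)) \<le> M / e"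
        by (intro onorm_real_scaleR_le) simp
    qed auto
    then show "norm (g (t, \<psi>) - g (t, \<xi>)) \<le> 1 / e * M" by simp
  qed
  then show ?thesis using Te by (meson divide_nonneg_pos zero_le_one)
qed

lemma lipschitz_hist_mono:
  assumes "lipschitz_hist V g t0 \<phi> T e L" "T \<le> T'" "e' \<le> e"
  shows "lipschitz_hist V g t0 \<phi> T' e' L"
  unfolding lipschitz_hist_def
proof (intro allI impI conjI)
  fix t \<psi> \<xi> M
  assume *: "\<bar>t - t0\<bar> < e'" "hist_close T' e' \<phi> \<psi>" "hist_close T' e' \<phi> \<xi>"
  then have **: "\<bar>t - t0\<bar> < e" "hist_close T e \<phi> \<psi>" "hist_close T e \<phi> \<xi>"
    using assms(2,3) by (auto intro: hist_close_mono)
  then show "(t, \<psi>) \<in> V" using assms(1) unfolding lipschitz_hist_def by blast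
  assume "\<forall>s\<in>{-T'..0}. norm (hist_apply \<psi> s - hist_apply \<xi> s) \<le> M"
  then have "\<forall>s\<in>{-T..0}. norm (hist_apply \<psi> s - hist_apply \<xi> s) \<le> M" using assms(2) by auto
  then show "norm (g (t, \<psi>) - g (t, \<xi>)) \<le> L * M"
    using ** assms(1) unfolding lipschitz_hist_def by blast
qed

section \<open>Existence and uniqueness\<close>

lemma seg_close:
  fixes x :: "real \<Rightarrow> 'a::real_normed_vector"
  assumes "continuous_on {..b} x" "t \<le> b" "e > 0"
  obtains d where "d > 0" "\<And>t'. t' \<le> b \<Longrightarrow> \<bar>t' - t\<bar> < d \<Longrightarrow> hist_close T e (seg x t) (seg x t')"
proof -
  \<comment> \<open>Closeness of segments over \<open>[-T, 0]\<close> is uniform continuity of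
    \<open>x\<close> on a compact interval. The extra unit on the left keeps \<open>t' + s\<close>
    inside when \<open>t'\<close> is within distance 1 of \<open>t\<close>.\<close>
  have "uniformly_continuous_on {t - T - 1..b} x"
    by (intro compact_uniformly_continuous continuous_on_subset[OF assms(1)]) auto
  then obtain d where d: "d > 0"
    "\<And>s s'. s \<in> {t - T - 1..b} \<Longrightarrow> s' \<in> {t - T - 1..b} \<Longrightarrow> dist s' s < d \<Longrightarrow> dist (x s') (x s) < e"
    using assms(3) unfolding uniformly_continuous_on_def by metis
  show ?thesis
  proof (rule that[of "min d 1"])
    fix t' assume t': "t' \<le> b" "\<bar>t' - t\<bar> < min d 1"
    have c: "continuous_on {..t} x" "continuous_on {..t'} x"
      using assms(2) t' by (auto intro: continuous_on_subset[OF assms(1)])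
    show "hist_close T e (seg x t) (seg x t')"
      unfolding hist_close_def
    proof
      fix s assume s: "s \<in> {-T..0}"
      have "dist (x (t' + s)) (x (t + s)) < e"
        using s t' assms(2) by (intro d(2)) (auto simp: dist_real_def)
      then show "dist (hist_apply (seg x t') s) (hist_apply (seg x t) s) < e"
        using s c by (simp add: hist_apply_seg)
    qed
  qed (use d in auto)
qed

lemma continuous_on_seg:
  fixes x :: "real \<Rightarrow> 'a::real_normed_vector"
  assumes "continuous_on {..b} x"
  shows "continuous_on {..b} (seg x)"
  unfolding continuous_on_def tendsto_hist_iff
proof (intro ballI allI impI)
  fix t T e :: real assume "t \<in> {..b}" "T > 0" "e > 0"
  then obtain d where "d > 0" "\<And>t'. t' \<le> b \<Longrightarrow> \<bar>t' - t\<bar> < d \<Longrightarrow> hist_close T e (seg x t) (seg x t')"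
    using seg_close[OF assms] by (metis atMost_iff)
  then show "\<forall>\<^sub>F t' in at t within {..b}. hist_close T e (seg x t) (seg x t')"
    unfolding eventually_at by (auto simp: dist_real_def)
qed

lemma seg_cong:
  assumes "\<And>s. s \<le> t \<Longrightarrow> x s = y s"
  shows "seg x t = seg y t"
  unfolding seg_def by (rule arg_cong[where f = Abs_hist]) (auto simp: assms)

lemma ereal_le_less: "s \<le> t \<Longrightarrow> ereal t < te \<Longrightarrow> ereal s < te"
  by (rule le_less_trans[of _ "ereal t"]) auto

lemma in_upto_time [simp]: "t \<in> upto_time t0 te \<longleftrightarrow> t0 \<le> t \<and> ereal t < te"
  by (simp add: upto_time_def)

lemma is_interval_upto_time: "is_interval (upto_time t0 te)"
  unfolding is_interval_1 by (auto intro: ereal_le_less)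

lemma ivp_solution_continuous:
  assumes "ivp_solution V g t0 \<phi> te x" "ereal t < te"
  shows "continuous_on {..t} x"
proof -
  have "max t t0 \<in> upto_time t0 te" using assms by (auto simp: ivp_solution_def max_def)
  then have "continuous_on {..max t t0} x"
    using assms(1) unfolding ivp_solution_def solution_on_def by blast
  then show ?thesis by (rule continuous_on_subset) auto
qed

lemma ivp_solution_initial:
  assumes "ivp_solution V g t0 \<phi> te x" "t \<le> t0"
  shows "x t = hist_apply \<phi> (t - t0)"
proof -
  have "continuous_on {..t0} x" "seg x t0 = \<phi>"
    using assms(1) ivp_solution_continuous[OF assms(1)] by (auto simp: ivp_solution_def)
  then show ?thesis using hist_apply_seg[of t0 x "t - t0"] assms(2) by simp
qed

lemma ivp_solution_within:
  assumes "ivp_solution V g t0 \<phi> te x" "t0 \<le> a" "ereal b < te" "t \<in> {a..b}"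
  shows "(t, seg x t) \<in> V" "(x has_vector_derivative g (t, seg x t)) (at t within {a..b})"
proof -
  have sub: "{a..b} \<subseteq> upto_time t0 te"
    using assms(2,3) by (auto intro: ereal_le_less)
  then have "t \<in> upto_time t0 te" using assms(4) by blast
  then have "(t, seg x t) \<in> V" "(x has_vector_derivative g (t, seg x t)) (at t within upto_time t0 te)"
    using assms(1) unfolding ivp_solution_def solution_on_def by blast+
  then show "(t, seg x t) \<in> V" "(x has_vector_derivative g (t, seg x t)) (at t within {a..b})"
    using has_vector_derivative_within_subset[OF _ sub] by auto
qed

text \<open>All that existence and uniqueness take from smoothness, so that both kinds are handled
  at once. Completeness of the value space serves integration and the fixed point theorem.\<close>

locale lipschitz_fde =
  fixes V :: "(real \<times> 'a::banach hist) set" and g :: "real \<times> 'a hist \<Rightarrow> 'a"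
  assumes open_domain: "open V"
    and continuous_rhs: "continuous_on V g"
    and lipschitz_rhs:
      "(t0, \<phi>) \<in> V \<Longrightarrow> \<exists>T>0. \<exists>e>0. \<exists>L\<ge>0. lipschitz_hist V g t0 \<phi> T e L"
begin

lemma continuous_on_rhs_seg:
  assumes "continuous_on {..b} x" "S \<subseteq> {..b}" "\<And>t. t \<in> S \<Longrightarrow> (t, seg x t) \<in> V"
  shows "continuous_on S (\<lambda>t. g (t, seg x t))"
proof (rule continuous_on_compose2[OF continuous_rhs])
  show "continuous_on S (\<lambda>t. (t, seg x t))"
    by (intro continuous_on_Pair continuous_on_id
        continuous_on_subset[OF continuous_on_seg[OF assms(1)] assms(2)])
qed (use assms(3) in auto)

section \<open>Uniqueness for the initial value problem\<close>

lemma unique_step: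
  assumes "a < b"
    and c1: "continuous_on {..b} x1" and c2: "continuous_on {..b} x2"
    and V: "(a, seg x1 a) \<in> V"
    and d1: "\<And>t. t \<in> {a..b} \<Longrightarrow> (x1 has_vector_derivative g (t, seg x1 t)) (at t within {a..b})"
    and d2: "\<And>t. t \<in> {a..b} \<Longrightarrow> (x2 has_vector_derivative g (t, seg x2 t)) (at t within {a..b})"
    and eq: "\<And>t. t \<le> a \<Longrightarrow> x1 t = x2 t"
  shows "\<exists>c>a. c \<le> b \<and> (\<forall>t\<le>c. x1 t = x2 t)"
proof -
  obtain T e L where T: "T > 0" "e > 0" "L \<ge> 0" and lip: "lipschitz_hist V g a (seg x1 a) T e L"
    using lipschitz_rhs[OF V] by blast
  have s2: "seg x2 a = seg x1 a" by (rule seg_cong) (simp add: eq)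
  obtain \<delta>1 where \<delta>1: "\<delta>1 > 0"
    "\<And>t. t \<le> b \<Longrightarrow> \<bar>t - a\<bar> < \<delta>1 \<Longrightarrow> hist_close T e (seg x1 a) (seg x1 t)"
    using seg_close[OF c1, of a e] assms(1) T by (metis less_imp_le)
  obtain \<delta>2 where \<delta>2: "\<delta>2 > 0"
    "\<And>t. t \<le> b \<Longrightarrow> \<bar>t - a\<bar> < \<delta>2 \<Longrightarrow> hist_close T e (seg x1 a) (seg x2 t)"
    using seg_close[OF c2, of a e] assms(1) T s2 by (metis less_imp_le)
  \<comment> \<open>The first four bounds keep \<open>c\<close> below \<open>b\<close> and, up to
    \<open>c\<close>, time and both segments inside the Lipschitz neighbourhood. The last one gives
    \<open>L * \<delta> \<le> 1 / 2\<close>; the summand 1 allows \<open>L = 0\<close>.\<close>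
  define \<delta> where "\<delta> = Min {b - a, \<delta>1 / 2, \<delta>2 / 2, e / 2, 1 / (2 * (L + 1))}"
  have \<delta>: "\<delta> > 0" "\<delta> \<le> b - a" "\<delta> < \<delta>1" "\<delta> < \<delta>2" "\<delta> < e" "\<delta> \<le> 1 / (2 * (L + 1))"
    using T \<delta>1(1) \<delta>2(1) assms(1) unfolding \<delta>_def by auto
  define c where "c = a + \<delta>"
  have c: "a < c" "c \<le> b" using \<delta> by (auto simp: c_def)
  have "continuous_on {a..c} (\<lambda>t. norm (x1 t - x2 t))"
    using c by (intro continuous_intros continuous_on_subset[OF c1] continuous_on_subset[OF c2]) auto
  then obtain tm where tm: "tm \<in> {a..c}" "\<And>t. t \<in> {a..c} \<Longrightarrow> norm (x1 t - x2 t) \<le> norm (x1 tm - x2 tm)"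
    using continuous_attains_sup[of "{a..c}" "\<lambda>t. norm (x1 t - x2 t)"] c by auto
  \<comment> \<open>The maximum over \<open>[a, c]\<close> bounds the difference on all of
    \<open>(-\<infinity>, c]\<close>, as the maps agree up to \<open>a\<close>; so it also bounds
    differences of segments. The mean value theorem between \<open>a\<close> and the maximum point
    \<open>tm\<close> gives \<open>M \<le> L * M * \<delta> \<le> M / 2\<close>, whence
    \<open>M = 0\<close>.\<close>
  define M where "M = norm (x1 tm - x2 tm)"
  have M: "M \<ge> 0" by (simp add: M_def)
  have le: "norm (x1 t - x2 t) \<le> M" if "t \<le> c" for t
  proof (cases "t \<le> a")
    case True then show ?thesis using eq M by simp
  next
    case False then show ?thesis using tm(2) that by (simp add: M_def)
  qed
  have "norm ((x1 tm - x2 tm) - (x1 a - x2 a)) \<le> L * M * norm (tm - a)"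
  proof (rule differentiable_bound[where S = "{a..c}" and f = "\<lambda>t. x1 t - x2 t"
        and f' = "\<lambda>t h. h *\<^sub>R (g (t, seg x1 t) - g (t, seg x2 t))"])
    fix t assume t: "t \<in> {a..c}"
    have "(x1 has_vector_derivative g (t, seg x1 t)) (at t within {a..c})"
      "(x2 has_vector_derivative g (t, seg x2 t)) (at t within {a..c})"
      using t c by (auto intro!: has_vector_derivative_within_subset[OF d1] has_vector_derivative_within_subset[OF d2])
    from has_vector_derivative_diff[OF this]
    show "((\<lambda>t. x1 t - x2 t) has_derivative (\<lambda>h. h *\<^sub>R (g (t, seg x1 t) - g (t, seg x2 t)))) (at t within {a..c})"
      by (simp add: has_vector_derivative_def)
    have ct: "continuous_on {..t} x1" "continuous_on {..t} x2"
      using t c by (auto intro: continuous_on_subset[OF c1] continuous_on_subset[OF c2])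
    have "norm (g (t, seg x1 t) - g (t, seg x2 t)) \<le> L * M"
    proof -
      have "\<bar>t - a\<bar> < e" "hist_close T e (seg x1 a) (seg x1 t)" "hist_close T e (seg x1 a) (seg x2 t)"
        using t c \<delta> by (auto simp: c_def intro!: \<delta>1(2) \<delta>2(2))
      moreover have "\<forall>s\<in>{-T..0}. norm (hist_apply (seg x1 t) s - hist_apply (seg x2 t) s) \<le> M"
        using t ct by (auto simp: hist_apply_seg intro!: le)
      ultimately show ?thesis using lip unfolding lipschitz_hist_def by blast
    qed
    then show "onorm (\<lambda>h. h *\<^sub>R (g (t, seg x1 t) - g (t, seg x2 t))) \<le> L * M"
      by (rule onorm_real_scaleR_le)
  qed (use tm c in auto)
  then have "M \<le> L * M * (tm - a)" using eq[of a] tm by (simp add: M_def)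
  also have "\<dots> \<le> L * M * \<delta>" using tm M T by (intro mult_left_mono) (auto simp: c_def)
  also have "\<dots> = M * (L * \<delta>)" by simp
  also have "\<dots> \<le> M * (1 / 2)"
  proof (rule mult_left_mono[OF _ M])
    have "L * \<delta> \<le> L * (1 / (2 * (L + 1)))" using \<delta>(6) T(3) by (rule mult_left_mono)
    also have "\<dots> \<le> 1 / 2" using T(3) by (simp add: field_simps)
    finally show "L * \<delta> \<le> 1 / 2" .
  qed
  finally have "M = 0" using M by simp
  then have "\<forall>t\<le>c. x1 t = x2 t" using le by fastforce
  then show ?thesis using c by blast
qed

text \<open>Let \<open>a\<close> be the supremum of the times up to which both solutions agree.
  Continuity gives agreement at \<open>a\<close> itself, and if \<open>a\<close> lay before
  \<open>\<tau>\<close>, then \<open>unique_step\<close> would carry the agreement beyond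
  \<open>a\<close>.\<close>

lemma ivp_solution_unique:
  assumes "ivp_solution V g t0 \<phi> te1 x1" "ivp_solution V g t0 \<phi> te2 x2"
    and "ereal \<tau> < te1" "ereal \<tau> < te2"
  shows "x1 \<tau> = x2 \<tau>"
proof (rule ccontr)
  assume neq: "x1 \<tau> \<noteq> x2 \<tau>"
  have init: "x1 t = x2 t" if "t \<le> t0" for t
    using ivp_solution_initial[OF assms(1) that] ivp_solution_initial[OF assms(2) that] by simp
  have t0: "t0 < \<tau>" using neq init by (meson not_le)
  have c1: "continuous_on {..\<tau>} x1" and c2: "continuous_on {..\<tau>} x2"
    using ivp_solution_continuous[OF assms(1,3)] ivp_solution_continuous[OF assms(2,4)] .
  define S where "S = {t. t \<le> \<tau> \<and> (\<forall>s\<le>t. x1 s = x2 s)}"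
  define a where "a = Sup S"
  have S: "t0 \<in> S" "bdd_above S"
    using init t0 by (simp_all add: S_def) (rule bdd_aboveI[of _ \<tau>], simp)
  have a: "t0 \<le> a" unfolding a_def by (rule cSup_upper[OF S])
  have a': "a \<le> \<tau>"
    unfolding a_def using S(1) by (intro cSup_least) (auto simp: S_def)
  have below: "x1 s = x2 s" if s: "s < a" for s
  proof -
    obtain t where "t \<in> S" "s < t" using s less_cSup_iff[of S s] S unfolding a_def by blast
    then show ?thesis by (auto simp: S_def)
  qed
  have "continuous_on (closure {..<a}) (\<lambda>s. x1 s - x2 s)"
    using a' by (intro continuous_intros continuous_on_subset[OF c1] continuous_on_subset[OF c2]) auto
  then have "x1 a - x2 a = 0"
    by (rule continuous_constant_on_closure) (auto simp: below)
  then have eq: "x1 s = x2 s" if "s \<le> a" for s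
    using below that by (cases "s = a") auto
  then have "a < \<tau>" using neq a' eq by (metis order.order_iff_strict)
  have "\<exists>c>a. c \<le> \<tau> \<and> (\<forall>t\<le>c. x1 t = x2 t)"
  proof (rule unique_step[OF \<open>a < \<tau>\<close> c1 c2])
    show "(a, seg x1 a) \<in> V"
      using ivp_solution_within(1)[OF assms(1) a assms(3), of a] a' by simp
  qed (use ivp_solution_within(2)[OF assms(1) a assms(3)] ivp_solution_within(2)[OF assms(2) a assms(4)] eq in auto)
  then obtain c where "c > a" "c \<in> S" by (auto simp: S_def)
  then show False using cSup_upper[of c S] S(2) by (simp add: a_def)
qed

section \<open>Local existence by the contraction principle\<close>

lemma lipschitz_bounded_nhd:
  assumes V: "(t0, \<phi>) \<in> V"
  obtains T e L K where "T > 0" "e > 0" "L \<ge> 0" "K \<ge> 0" "lipschitz_hist V g t0 \<phi> T e L"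
    "\<And>t \<psi>. \<bar>t - t0\<bar> < e \<Longrightarrow> hist_close T e \<phi> \<psi> \<Longrightarrow> norm (g (t, \<psi>)) \<le> K"
proof -
  obtain T1 e1 L where 1: "T1 > 0" "e1 > 0" "L \<ge> 0" "lipschitz_hist V g t0 \<phi> T1 e1 L"
    using lipschitz_rhs[OF V] by blast
  let ?K = "norm (g (t0, \<phi>)) + 1"
  have "open (g -` ball 0 ?K \<inter> V)"
    using continuous_rhs open_domain by (simp add: continuous_on_open_vimage)
  moreover have "(t0, \<phi>) \<in> g -` ball 0 ?K \<inter> V" using V by simp
  ultimately obtain T2 e2 where 2: "T2 > 0" "e2 > 0"
    "\<And>t \<psi>. \<bar>t - t0\<bar> < e2 \<Longrightarrow> hist_close T2 e2 \<phi> \<psi> \<Longrightarrow> (t, \<psi>) \<in> g -` ball 0 ?K \<inter> V"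
    using open_prod_hist_nhd by blast
  show ?thesis
  proof (rule that[of "max T1 T2" "min e1 e2" L ?K])
    show "lipschitz_hist V g t0 \<phi> (max T1 T2) (min e1 e2) L"
      by (rule lipschitz_hist_mono[OF 1(4)]) auto
    fix t \<psi> assume "\<bar>t - t0\<bar> < min e1 e2" and \<psi>: "hist_close (max T1 T2) (min e1 e2) \<phi> \<psi>"
    moreover have "hist_close T2 e2 \<phi> \<psi>" by (rule hist_close_mono[OF \<psi>]) auto
    ultimately show "norm (g (t, \<psi>)) \<le> ?K" using 2(3)[of t \<psi>] by simp
  qed (use 1 2 in auto)
qed

text \<open>The unknown is the correction \<open>w\<close> in \<open>x = p + w\<close>, where
  \<open>p\<close> continues \<open>\<phi>\<close> past \<open>t0\<close> by the constant
  \<open>\<phi>(0)\<close>. Corrections are bounded even though \<open>\<phi>\<close> need not be,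
  so the contraction principle applies in the complete space of bounded continuous functions on the
  line.\<close>

lemma ivp_solution_exists:
  assumes V: "(t0, \<phi>) \<in> V"
  shows "\<exists>te x. ivp_solution V g t0 \<phi> te x"
proof -
  obtain T e L K where T: "T > 0" "e > 0" and L: "L \<ge> 0" and K: "K \<ge> 0"
    and lip: "lipschitz_hist V g t0 \<phi> T e L"
    and bd: "\<And>t \<psi>. \<bar>t - t0\<bar> < e \<Longrightarrow> hist_close T e \<phi> \<psi> \<Longrightarrow> norm (g (t, \<psi>)) \<le> K"
    using lipschitz_bounded_nhd[OF V] by blast
  define p where "p \<tau> = hist_apply \<phi> (min (\<tau> - t0) 0)" for \<tau>
  have p: "continuous_on UNIV p"
    unfolding p_def by (rule continuous_on_compose2[OF continuous_on_hist]) (auto intro!: continuous_intros)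
  have p_le: "continuous_on {..t} p" for t by (rule continuous_on_subset[OF p]) auto
  have seg_p: "seg p t0 = \<phi>"
    by (rule hist_eqI) (simp add: hist_apply_seg[OF p_le] p_def)
  obtain d where d: "d > 0"
    "\<And>t. t \<le> t0 + 1 \<Longrightarrow> \<bar>t - t0\<bar> < d \<Longrightarrow> hist_close T (e / 2) (seg p t0) (seg p t)"
    using seg_close[OF p_le[of "t0 + 1"], of t0 "e / 2" T] T by auto
  define r where "r = e / 2"
  \<comment> \<open>The bounds 1 and \<open>d / 2\<close> keep segments of \<open>p\<close> within
    \<open>e / 2\<close> of \<open>\<phi>\<close>, and \<open>e / 2\<close> controls time. The bound
    with \<open>K\<close> makes the integral operator preserve the radius \<open>r\<close>, and the
    one with \<open>L\<close> makes it a contraction with constant 1/2.\<close>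
  define \<delta> where "\<delta> = Min {1, d / 2, e / 2, r / (K + 1), 1 / (2 * (L + 1))}"
  have \<delta>: "\<delta> > 0" "\<delta> \<le> 1" "\<delta> < d" "\<delta> < e" "\<delta> \<le> r / (K + 1)" "\<delta> \<le> 1 / (2 * (L + 1))"
    using T d(1) L K unfolding \<delta>_def r_def by auto
  have "K * \<delta> \<le> K * (r / (K + 1))" using \<delta>(5) K by (rule mult_left_mono)
  also have "\<dots> \<le> r" using K T by (simp add: field_simps r_def)
  finally have K\<delta>: "K * \<delta> \<le> r" .
  have "L * \<delta> \<le> L * (1 / (2 * (L + 1)))" using \<delta>(6) L by (rule mult_left_mono)
  also have "\<dots> \<le> 1 / 2" using L by (simp add: field_simps)
  finally have L\<delta>: "L * \<delta> \<le> 1 / 2" .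

  let ?I = "{t0..t0 + \<delta>}"
  \<comment> \<open>Corrections vanish up to \<open>t0\<close> and are bounded by \<open>r\<close>
    afterwards. Written as a pointwise constraint to closed sets, \<open>X\<close> is closed and
    therefore complete.\<close>
  define X where "X = PiC UNIV (\<lambda>t. if t \<le> t0 then {0 :: 'a} else cball 0 r)"
  define x where "x w \<tau> = p \<tau> + apply_bcontfun w \<tau>" for w and \<tau> :: real
  define F where "F w t = g (t, seg (x w) t)" for w t
  \<comment> \<open>Clamping the upper limit to \<open>[t0, t0 + \<delta>]\<close> makes the
    integral a bounded continuous function on the whole line which is 0 before
    \<open>t0\<close>.\<close>
  define cl where "cl t = max t0 (min t (t0 + \<delta>))" for t
  define A where "A w = Bcontfun (\<lambda>t. integral {t0..cl t} (F w))" for w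
  have cl: "cl t \<in> ?I" for t using \<delta>(1) by (auto simp: cl_def)
  have X0: "apply_bcontfun w t = 0" if "w \<in> X" "t \<le> t0" for w t
    using that by (auto simp: X_def mem_PiC_iff Pi_def split: if_splits)
  have Xr: "norm (apply_bcontfun w t) \<le> r" if "w \<in> X" for w t
    using that T by (cases "t \<le> t0") (auto simp: X_def mem_PiC_iff Pi_def r_def split: if_splits)
  have x: "continuous_on {..t} (x w)" for w t
    unfolding x_def by (intro continuous_intros p_le) auto
  have near: "hist_close T e \<phi> (seg (x w) t)" if "w \<in> X" "t \<in> ?I" for w t
    unfolding hist_close_def
  proof
    fix s assume s: "s \<in> {-T..0}"
    have "hist_close T (e / 2) \<phi> (seg p t)"
      using d(2)[of t] that \<delta> by (simp add: seg_p)
    then have "dist (p (t + s)) (hist_apply \<phi> s) < e / 2"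
      using s by (simp add: hist_close_def hist_apply_seg[OF p_le])
    moreover have "norm (apply_bcontfun w (t + s)) \<le> e / 2"
      using Xr[OF that(1)] by (simp add: r_def)
    moreover have "p (t + s) + apply_bcontfun w (t + s) - hist_apply \<phi> s
        = (p (t + s) - hist_apply \<phi> s) + apply_bcontfun w (t + s)" by simp
    ultimately have "dist (x w (t + s)) (hist_apply \<phi> s) < e"
      unfolding x_def dist_norm by (metis norm_triangle_lt field_sum_of_halves add_less_le_mono)
    then show "dist (hist_apply (seg (x w) t) s) (hist_apply \<phi> s) < e"
      using s by (simp add: hist_apply_seg[OF x])
  qed
  have time: "\<bar>t - t0\<bar> < e" if "t \<in> ?I" for t using that \<delta> by auto
  have inV: "(t, seg (x w) t) \<in> V" if "w \<in> X" "t \<in> ?I" for w t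
    using lip near[OF that] time[OF that(2)] unfolding lipschitz_hist_def by blast
  have F: "continuous_on ?I (F w)" if "w \<in> X" for w
    unfolding F_def using inV[OF that] by (intro continuous_on_rhs_seg[OF x[where t = "t0 + \<delta>"]]) auto
  have F_bound: "norm (F w t) \<le> K" if "w \<in> X" "t \<in> ?I" for w t
    unfolding F_def using near[OF that] time[OF that(2)] by (rule bd[rotated])
  have F_lip: "norm (F w t - F w' t) \<le> L * dist w w'" if "w \<in> X" "w' \<in> X" "t \<in> ?I" for w w' t
  proof -
    have "\<forall>s\<in>{-T..0}. norm (hist_apply (seg (x w) t) s - hist_apply (seg (x w') t) s) \<le> dist w w'"
      using dist_bounded[of w _ w'] by (simp add: hist_apply_seg[OF x] x_def dist_norm)
    then show ?thesis
      using lip near[OF that(1,3)] near[OF that(2,3)] time[OF that(3)]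
      unfolding F_def lipschitz_hist_def by blast
  qed
  have integrable: "F w integrable_on ?I" if "w \<in> X" for w
    using F[OF that] by (rule integrable_continuous_real)
  have small: "norm (integral {t0..cl t} f) \<le> B * \<delta>"
    if "continuous_on ?I f" "\<And>s. s \<in> ?I \<Longrightarrow> norm (f s) \<le> B" for f :: "real \<Rightarrow> 'a" and B t
  proof -
    have B: "B \<ge> 0" using order_trans[OF norm_ge_zero that(2)[of t0]] \<delta> by simp
    have "norm (integral {t0..cl t} f) \<le> B * (cl t - t0)"
      using cl[of t] that by (intro integral_bound continuous_on_subset[OF that(1)]) auto
    also have "\<dots> \<le> B * \<delta>" using cl[of t] B by (intro mult_left_mono) auto
    finally show ?thesis .
  qed
  have A: "apply_bcontfun (A w) t = integral {t0..cl t} (F w)" if "w \<in> X" for w t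
  proof -
    have "continuous_on UNIV (\<lambda>t. integral {t0..cl t} (F w))"
      by (rule continuous_on_compose2[OF indefinite_integral_continuous_1[OF integrable[OF that]]])
        (use cl in \<open>auto simp: cl_def intro!: continuous_intros\<close>)
    moreover have "norm (integral {t0..cl t} (F w)) \<le> K * \<delta>" for t
      using F[OF that] F_bound[OF that] by (rule small)
    ultimately show ?thesis
      unfolding A_def by (subst Bcontfun_inverse) (auto intro: bcontfun_normI)
  qed
  have "\<exists>!w\<in>X. A w = w"
  proof (rule Banach_fix)
    have "closed X" unfolding X_def by (rule closed_PiC) auto
    then show "complete X" by (simp add: complete_eq_closed)
    have "const_bcontfun 0 \<in> X" using T by (auto simp: X_def mem_PiC_iff r_def)
    then show "X \<noteq> {}" by blast
    show "A ` X \<subseteq> X"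
    proof
      fix v assume "v \<in> A ` X"
      then obtain w where w: "w \<in> X" "v = A w" by blast
      have "norm (integral {t0..cl t} (F w)) \<le> r" for t
        using small[OF F F_bound, OF w(1) w(1), of t] K\<delta> by simp
      moreover have "integral {t0..cl t} (F w) = 0" if "t \<le> t0" for t
        using that \<delta>(1) by (simp add: cl_def)
      ultimately show "v \<in> X" using w by (auto simp: X_def mem_PiC_iff A[OF w(1)])
    qed
    show "dist (A w) (A w') \<le> 1 / 2 * dist w w'" if "w \<in> X" "w' \<in> X" for w w'
    proof (rule dist_bound)
      fix t
      have sub: "{t0..cl t} \<subseteq> ?I" using cl[of t] by auto
      have "dist (A w t) (A w' t) = norm (integral {t0..cl t} (\<lambda>s. F w s - F w' s))"
        using integrable_subinterval_real[OF integrable[OF that(1)] sub]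
          integrable_subinterval_real[OF integrable[OF that(2)] sub]
        by (simp add: A that dist_norm integral_diff)
      also have "\<dots> \<le> L * dist w w' * \<delta>"
        using that by (intro small continuous_on_diff F F_lip)
      also have "\<dots> = (L * \<delta>) * dist w w'" by simp
      also have "\<dots> \<le> 1 / 2 * dist w w'" using L\<delta> by (rule mult_right_mono) simp
      finally show "dist (A w t) (A w' t) \<le> 1 / 2 * dist w w'" .
    qed
  qed auto
  then obtain w where w: "w \<in> X" "A w = w" by blast
  have sub: "upto_time t0 (ereal (t0 + \<delta>)) \<subseteq> ?I" by auto
  \<comment> \<open>On this interval \<open>p\<close> is constant and the clamp is the identity, so
    the fixed point equation is the integral form of the differential equation.\<close>
  have "(x w has_vector_derivative F w t) (at t within ?I)" if t: "t \<in> ?I" for t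
  proof (rule has_vector_derivative_transform[OF t])
    show "((\<lambda>t. hist_apply \<phi> 0 + integral {t0..t} (F w)) has_vector_derivative F w t) (at t within ?I)"
      using has_vector_derivative_add[OF has_vector_derivative_const
          integral_has_vector_derivative[OF F[OF w(1)] t]] by simp
    fix t assume "t \<in> ?I"
    then show "x w t = hist_apply \<phi> 0 + integral {t0..t} (F w)"
      using A[OF w(1), of t] w(2) by (simp add: x_def p_def cl_def)
  qed
  then have der: "(x w has_vector_derivative F w t) (at t within upto_time t0 (ereal (t0 + \<delta>)))"
    if "t \<in> upto_time t0 (ereal (t0 + \<delta>))" for t
    using has_vector_derivative_within_subset[OF _ sub] that sub by blast
  have "seg (x w) t0 = seg p t0" by (rule seg_cong) (simp add: x_def X0[OF w(1)])
  then have "ivp_solution V g t0 \<phi> (ereal (t0 + \<delta>)) (x w)"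
    unfolding ivp_solution_def solution_on_def
    using \<delta>(1) x inV[OF w(1)] sub der
    by (auto simp: is_interval_upto_time seg_p F_def simp del: in_upto_time)
  then show ?thesis by blast
qed

section \<open>The greatest solution, glued from all solutions\<close>

lemma ivp_solution_maximal:
  assumes "(t0, \<phi>) \<in> V"
  obtains te x where "ivp_solution V g t0 \<phi> te x"
    "\<And>te' x'. ivp_solution V g t0 \<phi> te' x' \<Longrightarrow> te' \<le> te \<and> (\<forall>\<tau>. ereal \<tau> < te' \<longrightarrow> x' \<tau> = x \<tau>)"
proof -
  define E where "E = {te. \<exists>x. ivp_solution V g t0 \<phi> te x}"
  define te where "te = Sup E"
  \<comment> \<open>By uniqueness the value at \<open>\<tau>\<close> is the same for every solution
    defined there, so the choice is harmless.\<close>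
  define x where "x \<tau> = (SOME v. \<exists>te' x'. ivp_solution V g t0 \<phi> te' x' \<and> ereal \<tau> < te' \<and> v = x' \<tau>)" for \<tau>
  have x: "x \<tau> = x' \<tau>" if "ivp_solution V g t0 \<phi> te' x'" "ereal \<tau> < te'" for te' x' \<tau>
    unfolding x_def
  proof (rule some_equality)
    show "\<exists>te' x''. ivp_solution V g t0 \<phi> te' x'' \<and> ereal \<tau> < te' \<and> x' \<tau> = x'' \<tau>"
      using that by blast
  qed (use ivp_solution_unique[OF _ that(1) _ that(2)] in blast)
  have le: "te' \<le> te" if "ivp_solution V g t0 \<phi> te' x'" for te' x'
    unfolding te_def using that by (intro Sup_upper) (auto simp: E_def)
  have ext: "\<exists>te' x'. ivp_solution V g t0 \<phi> te' x' \<and> ereal t < te'" if "ereal t < te" for t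
    using that unfolding te_def less_Sup_iff E_def by blast
  obtain te0 x0 where 0: "ivp_solution V g t0 \<phi> te0 x0" using ivp_solution_exists[OF assms] by blast
  then have "ereal t0 < te" using le[OF 0] by (auto simp: ivp_solution_def)
  moreover have "seg x t0 = seg x0 t0"
    using 0 by (intro seg_cong x[OF 0]) (auto simp: ivp_solution_def intro: ereal_le_less)
  moreover have "continuous_on {..t} x \<and> (t, seg x t) \<in> V \<and>
      (x has_vector_derivative g (t, seg x t)) (at t within upto_time t0 te)"
    if t: "t \<in> upto_time t0 te" for t
  proof -
    obtain te' x' where x': "ivp_solution V g t0 \<phi> te' x'" "ereal t < te'" using ext[of t] t by auto
    have eq: "x s = x' s" if "s \<le> t" for s
      using x[OF x'(1)] x'(2) that by (auto intro: ereal_le_less)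
    have seg: "seg x t = seg x' t" by (rule seg_cong) (rule eq)
    have t': "t \<in> upto_time t0 te'" using t x' by auto
    then have *: "continuous_on {..t} x'" "(t, seg x' t) \<in> V"
        "(x' has_vector_derivative g (t, seg x' t)) (at t within upto_time t0 te')"
      using x'(1) unfolding ivp_solution_def solution_on_def by blast+
    have "continuous_on {..t} x" using *(1) by (rule continuous_on_eq) (simp add: eq)
    moreover have "(x has_vector_derivative g (t, seg x t)) (at t within upto_time t0 te)"
    proof -
      \<comment> \<open>Below \<open>te'\<close> the two half-open intervals coincide on an open
        neighbourhood of \<open>t\<close>, so derivatives within them are the same; at
        \<open>t0\<close> both are right derivatives.\<close>
      define S where "S = {s. ereal s < te'}"
      have S: "open S" unfolding S_def by (cases te') (auto simp: open_Collect_less)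
      have "upto_time t0 te \<inter> S = upto_time t0 te' \<inter> S"
        using le[OF x'(1)] by (auto simp: S_def intro: less_le_trans)
      then have "at t within upto_time t0 te = at t within upto_time t0 te'"
        using S x'(2) by (intro at_within_nhd[of t S]) (auto simp: S_def)
      moreover have "(x has_vector_derivative g (t, seg x t)) (at t within upto_time t0 te')"
        unfolding seg using t' _ *(3) by (rule has_vector_derivative_transform) (simp add: x[OF x'(1)])
      ultimately show ?thesis by simp
    qed
    ultimately show ?thesis using *(2) seg by simp
  qed
  ultimately have "ivp_solution V g t0 \<phi> te x"
    using 0 is_interval_upto_time unfolding ivp_solution_def solution_on_def by auto
  then show thesis
    by (rule that) (use le x in auto)
qed

end

section \<open>Reduction of the autonomous equation\<close>

lemma ereal_less_minus_real: "ereal u < te - ereal t0 \<longleftrightarrow> ereal (t0 + u) < te"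
  by (cases te) (auto simp: algebra_simps)

lemma upto_time_shift: "(\<lambda>\<tau>. \<tau> - t0) ` upto_time t0 te = upto_time 0 (te - ereal t0)"
proof (intro equalityI subsetI)
  fix u assume "u \<in> upto_time 0 (te - ereal t0)"
  then show "u \<in> (\<lambda>\<tau>. \<tau> - t0) ` upto_time t0 te"
    by (intro image_eqI[of _ _ "t0 + u"]) (auto simp: ereal_less_minus_real)
qed (auto simp: ereal_less_minus_real)

lemma upto_time_shift': "(\<lambda>u. t0 + u) ` upto_time 0 (te - ereal t0) = upto_time t0 te"
proof (intro equalityI subsetI)
  fix t assume "t \<in> upto_time t0 te"
  then show "t \<in> (\<lambda>u. t0 + u) ` upto_time 0 (te - ereal t0)"
    by (intro image_eqI[of _ _ "t - t0"]) (auto simp: ereal_less_minus_real)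
qed (auto simp: ereal_less_minus_real)

lemma auto_solution_domain:
  assumes "0 < te"
  shows "{s + t | s t. s \<le> 0 \<and> t \<in> upto_time 0 te} = {u. ereal u < te}"
proof (intro equalityI subsetI)
  fix u assume u: "u \<in> {u. ereal u < te}"
  have "u = min u 0 + max u 0" by simp
  moreover have "max u 0 \<in> upto_time 0 te" using u assms by (auto simp: max_def zero_ereal_def)
  ultimately show "u \<in> {s + t | s t. s \<le> 0 \<and> t \<in> upto_time 0 te}" by fastforce
qed (auto intro: ereal_le_less[rotated])

lemma p_n_seg:
  fixes y :: "real \<Rightarrow> real \<times> 'a::real_normed_vector"
  assumes "continuous_on {..u} y"
  shows "p_n (seg y u) = seg (\<lambda>\<tau>. snd (y (\<tau> - t0))) (t0 + u)"
proof (rule hist_eqI)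
  fix s :: real assume s: "s \<le> 0"
  have "continuous_on {..t0 + u} (\<lambda>\<tau>. snd (y (\<tau> - t0)))"
    by (intro continuous_on_snd continuous_on_compose2[OF assms]) (auto intro!: continuous_intros)
  then show "hist_apply (p_n (seg y u)) s = hist_apply (seg (\<lambda>\<tau>. snd (y (\<tau> - t0))) (t0 + u)) s"
    using s by (simp add: p_n.rep_eq hist_apply_seg assms)
qed

lemma p_fst_seg:
  assumes "continuous_on {..u} y"
  shows "hist_apply (p_fst (seg y u)) 0 = fst (y u)"
  by (simp add: p_fst.rep_eq hist_apply_seg[OF assms])

lemma hist_apply_start:
  "s \<le> 0 \<Longrightarrow> hist_apply (hist_pair (shift_star t0) \<phi>) s = (t0 + s, hist_apply \<phi> s)"
  by (simp add: hist_pair.rep_eq shift_star.rep_eq)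

lemma auto_ivp_solution_continuous:
  assumes "auto_ivp_solution U f \<psi> te y" "ereal u < te"
  shows "continuous_on {..u} y"
proof -
  have "continuous_on {u. ereal u < te} y"
    using assms(1) auto_solution_domain[of te] unfolding auto_ivp_solution_def auto_solution_on_def by simp
  then show ?thesis
    by (rule continuous_on_subset) (use assms(2) in \<open>auto intro: ereal_le_less\<close>)
qed

text \<open>The first component of \<open>f_g\<close> is 1, so \<open>fst (y s) - s\<close> has
  derivative 0 on \<open>[0, u]\<close> and keeps its initial value \<open>t0\<close>. The first
  component is thus a clock showing the time of the nonautonomous equation.\<close>

lemma auto_ivp_solution_time:
  fixes V :: "(real \<times> 'a::real_normed_vector hist) set"
  assumes y: "auto_ivp_solution (U_g V) (f_g g) (hist_pair (shift_star t0) \<phi>) te y" and u: "ereal u < te"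
  shows "fst (y u) = t0 + u"
proof -
  have init: "fst (y s) = t0 + s" if "s \<le> 0" for s
  proof -
    have "ereal 0 < te" "seg y 0 = hist_pair (shift_star t0) \<phi>"
      using y by (auto simp: auto_ivp_solution_def zero_ereal_def)
    then have "y s = (t0 + s, hist_apply \<phi> s)"
      using hist_apply_seg[OF auto_ivp_solution_continuous[OF y], of 0 s] that by (simp add: hist_apply_start)
    then show ?thesis by simp
  qed
  show ?thesis
  proof (cases "u \<le> 0")
    case False
    have sub: "{0..u} \<subseteq> upto_time 0 te" using u by (auto intro: ereal_le_less)
    have "((\<lambda>s. fst (y s) - s) has_derivative (\<lambda>h. 0)) (at s within {0..u})" if "s \<in> {0..u}" for s
    proof -
      have "(y has_vector_derivative f_g g (seg y s)) (at s within upto_time 0 te)"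
        using y that sub unfolding auto_ivp_solution_def auto_solution_on_def by blast
      then have "(y has_derivative (\<lambda>h. h *\<^sub>R f_g g (seg y s))) (at s within {0..u})"
        unfolding has_vector_derivative_def by (rule has_derivative_subset) (rule sub)
      then have "((\<lambda>s. fst (y s) - s) has_derivative (\<lambda>h. fst (h *\<^sub>R f_g g (seg y s)) - h)) (at s within {0..u})"
        by (intro has_derivative_diff has_derivative_fst has_derivative_ident)
      then show ?thesis by (simp add: f_g_def)
    qed
    then obtain c where "\<And>s. s \<in> {0..u} \<Longrightarrow> fst (y s) - s = c"
      using has_derivative_zero_constant[of "{0..u}" "\<lambda>s. fst (y s) - s"] by auto
    from this[of 0] this[of u] show ?thesis using False init[of 0] by simp
  qed (rule init)
qed

text \<open>With the clock reading \<open>t\<close>, membership of the segment in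
  \<open>U_g V\<close> becomes \<open>(t, x_t) \<in> V\<close>, and the second component of
  \<open>f_g\<close> becomes \<open>g (t, x_t)\<close>. The chain rule handles the shift of
  time.\<close>

lemma auto_ivp_solution_imp_ivp_solution:
  fixes V :: "(real \<times> 'a::real_normed_vector hist) set"
  assumes y: "auto_ivp_solution (U_g V) (f_g g) (hist_pair (shift_star t0) \<phi>) (te - ereal t0) y"
  shows "ivp_solution V g t0 \<phi> te (\<lambda>\<tau>. snd (y (\<tau> - t0)))"
proof -
  let ?x = "\<lambda>\<tau>. snd (y (\<tau> - t0))"
  have te: "ereal t0 < te"
    using y ereal_less_minus_real[of 0 te t0] by (simp add: auto_ivp_solution_def zero_ereal_def)
  have cy: "continuous_on {..t - t0} y" if "ereal t < te" for t
    using that by (intro auto_ivp_solution_continuous[OF y]) (simp add: ereal_less_minus_real)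
  have seg: "p_n (seg y (t - t0)) = seg ?x t" if "ereal t < te" for t
    using p_n_seg[OF cy[OF that], of t0] by simp
  have "seg ?x t0 = p_n (hist_pair (shift_star t0) \<phi>)"
    using seg[OF te] y by (simp add: auto_ivp_solution_def)
  also have "\<dots> = \<phi>" by (rule hist_eqI) (simp add: p_n.rep_eq hist_pair.rep_eq)
  finally have "seg ?x t0 = \<phi>" .
  moreover have "continuous_on {..t} ?x \<and> (t, seg ?x t) \<in> V \<and>
        (?x has_vector_derivative g (t, seg ?x t)) (at t within upto_time t0 te)"
    if t: "t \<in> upto_time t0 te" for t
  proof -
    have t': "ereal t < te" "t - t0 \<in> upto_time 0 (te - ereal t0)"
      using t by (auto simp: ereal_less_minus_real)
    have fst: "hist_apply (p_fst (seg y (t - t0))) 0 = t"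
      using auto_ivp_solution_time[OF y, of "t - t0"] t' by (simp add: p_fst_seg[OF cy])
    have *: "seg y (t - t0) \<in> U_g V"
        "(y has_vector_derivative f_g g (seg y (t - t0))) (at (t - t0) within upto_time 0 (te - ereal t0))"
      using y t'(2) unfolding auto_ivp_solution_def auto_solution_on_def by blast+
    have f: "f_g g (seg y (t - t0)) = (1, g (t, seg ?x t))"
      by (simp add: f_g_def fst seg[OF t'(1)])
    have "((\<lambda>\<tau>. \<tau> - t0) has_vector_derivative 1) (at t within upto_time t0 te)"
      by (auto intro!: derivative_eq_intros)
    from vector_diff_chain_within[OF this, unfolded upto_time_shift, OF *(2)]
    have "((\<lambda>\<tau>. y (\<tau> - t0)) has_vector_derivative (1, g (t, seg ?x t))) (at t within upto_time t0 te)"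
      by (simp add: f o_def)
    then have "(?x has_vector_derivative g (t, seg ?x t)) (at t within upto_time t0 te)"
      by (auto simp: has_vector_derivative_def dest: has_derivative_snd)
    moreover have "(t, seg ?x t) \<in> V" using *(1) by (simp add: U_g_def fst seg[OF t'(1)])
    moreover have "continuous_on {..t} ?x"
      by (intro continuous_on_snd continuous_on_compose2[OF cy[OF t'(1)]]) (auto intro!: continuous_intros)
    ultimately show ?thesis by blast
  qed
  ultimately show ?thesis
    using te is_interval_upto_time unfolding ivp_solution_def solution_on_def by auto
qed

text \<open>Adjoining the clock \<open>t0 + u\<close> to a solution inverts the previous
  construction. Both directions together make the two maximal existence problems equivalent.\<close>

lemma ivp_solution_imp_auto_ivp_solution:
  fixes V :: "(real \<times> 'a::real_normed_vector hist) set"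
  assumes x: "ivp_solution V g t0 \<phi> te x"
  shows "auto_ivp_solution (U_g V) (f_g g) (hist_pair (shift_star t0) \<phi>) (te - ereal t0)
    (\<lambda>u. (t0 + u, x (t0 + u)))"
proof -
  let ?y = "\<lambda>u. (t0 + u, x (t0 + u))"
  have te: "0 < te - ereal t0"
    using x ereal_less_minus_real[of 0 te t0] by (simp add: ivp_solution_def zero_ereal_def)
  have cx: "continuous_on {..t0 + u} x" if "ereal u < te - ereal t0" for u
    using that by (intro ivp_solution_continuous[OF x]) (simp add: ereal_less_minus_real)
  have cy: "continuous_on {..u} ?y" if "ereal u < te - ereal t0" for u
    by (intro continuous_intros continuous_on_compose2[OF cx[OF that]]) auto
  have seg: "p_n (seg ?y u) = seg x (t0 + u)" if "ereal u < te - ereal t0" for u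
    using p_n_seg[OF cy[OF that], of t0] by simp
  have "seg ?y 0 = hist_pair (shift_star t0) \<phi>"
  proof (rule hist_eqI)
    fix s :: real assume "s \<le> 0"
    then show "hist_apply (seg ?y 0) s = hist_apply (hist_pair (shift_star t0) \<phi>) s"
      using te by (simp add: hist_apply_seg[OF cy] zero_ereal_def hist_apply_start ivp_solution_initial[OF x])
  qed
  \<comment> \<open>Continuity is known on each closed half-line up to \<open>u\<close>. Open
    half-lines are used to patch it together, and density of the reals puts every point of the
    domain into one of them.\<close>
  moreover have "continuous_on {s + t | s t. s \<le> 0 \<and> t \<in> upto_time 0 (te - ereal t0)} ?y"
    unfolding auto_solution_domain[OF te]
  proof (rule continuous_on_open_Union[of "{{..<u} | u. ereal u < te - ereal t0}", THEN continuous_on_subset])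
    fix S assume "S \<in> {{..<u} | u. ereal u < te - ereal t0}"
    then obtain u where S: "S = {..<u}" "ereal u < te - ereal t0" by blast
    show "open S" by (simp add: S)
    show "continuous_on S ?y"
      unfolding S by (rule continuous_on_subset[OF cy[OF S(2)]]) auto
  next
    show "{u. ereal u < te - ereal t0} \<subseteq> \<Union> {{..<u} | u. ereal u < te - ereal t0}"
    proof
      fix u assume "u \<in> {u. ereal u < te - ereal t0}"
      then obtain v where "ereal u < ereal v" "ereal v < te - ereal t0"
        using ereal_dense2[of "ereal u"] by auto
      then show "u \<in> \<Union> {{..<u} | u. ereal u < te - ereal t0}" by auto
    qed
  qed
  moreover have "seg ?y u \<in> U_g V \<and>
      (?y has_vector_derivative f_g g (seg ?y u)) (at u within upto_time 0 (te - ereal t0))"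
    if u: "u \<in> upto_time 0 (te - ereal t0)" for u
  proof -
    have u': "ereal u < te - ereal t0" "t0 + u \<in> upto_time t0 te"
      using u by (auto simp: ereal_less_minus_real)
    have *: "(t0 + u, seg x (t0 + u)) \<in> V"
        "(x has_vector_derivative g (t0 + u, seg x (t0 + u))) (at (t0 + u) within upto_time t0 te)"
      using x u'(2) unfolding ivp_solution_def solution_on_def by blast+
    have shift: "((\<lambda>u. t0 + u) has_vector_derivative 1) (at u within upto_time 0 (te - ereal t0))"
      by (auto intro!: derivative_eq_intros)
    from vector_diff_chain_within[OF this, unfolded upto_time_shift', OF *(2)]
    have "((\<lambda>u. x (t0 + u)) has_vector_derivative g (t0 + u, seg x (t0 + u)))
        (at u within upto_time 0 (te - ereal t0))"
      by (simp add: o_def)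
    from has_vector_derivative_Pair[OF shift this] *(1) show ?thesis
      by (simp add: U_g_def f_g_def p_fst_seg[OF cy[OF u'(1)]] seg[OF u'(1)])
  qed
  ultimately show ?thesis
    using te is_interval_upto_time unfolding auto_ivp_solution_def auto_solution_on_def by auto
qed

section \<open>Conclusion: the process read off from the greatest solution\<close>

lemma C1_imp_lipschitz_fde:
  fixes V :: "(real \<times> 'a::banach hist) set"
  assumes "C1_MB V g \<or> C1_F V g"
  shows "lipschitz_fde V g"
proof
  have "Dh_locally_bounded V g"
    using assms C1_MB_imp_Dh_locally_bounded C1_F_imp_Dh_locally_bounded by blast
  moreover have "has_dir_derivs V g" using assms by (auto simp: C1_MB_def C1_F_def)
  ultimately show "\<exists>T>0. \<exists>e>0. \<exists>L\<ge>0. lipschitz_hist V g t0 \<phi> T e L" if "(t0, \<phi>) \<in> V" for t0 \<phi>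
    using that by (rule Dh_locally_bounded_imp_lipschitz)
qed (use assms in \<open>auto simp: C1_MB_def C1_F_def\<close>)

theorem corollary6p2:
  fixes V :: "(real \<times> (real ^ 'n) hist) set"
    and g :: "real \<times> (real ^ 'n) hist \<Rightarrow> real ^ 'n"
  assumes "open V"
    and "C1_MB V g \<or> C1_F V g"
  shows "\<forall>(t, t0, \<phi>) \<in> process_dom V g.
    \<exists>te x. ivp_solution V g t0 \<phi> te x \<and>
      (\<forall>te' x'. ivp_solution V g t0 \<phi> te' x' \<longrightarrow>
         te' \<le> te \<and> (\<forall>\<tau>. ereal \<tau> < te' \<longrightarrow> x' \<tau> = x \<tau>)) \<and>
      ereal t < te \<and> process V g t t0 \<phi> = seg x t"
proof (clarify)
  fix t t0 \<phi> assume dom: "(t, t0, \<phi>) \<in> process_dom V g"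
  interpret lipschitz_fde V g using assms(2) by (rule C1_imp_lipschitz_fde)
  let ?\<psi> = "hist_pair (shift_star t0) \<phi>"
  let ?sol = "auto_ivp_solution (U_g V) (f_g g) ?\<psi>"
  let ?max = "auto_maximal_solution (U_g V) (f_g g) ?\<psi>"
  have "p_n ?\<psi> = \<phi>" "hist_apply (p_fst ?\<psi>) 0 = t0"
    by (auto intro!: hist_eqI simp: p_n.rep_eq p_fst.rep_eq hist_pair.rep_eq shift_star.rep_eq)
  then have V: "(t0, \<phi>) \<in> V"
    using dom by (auto simp: process_dom_def Omega_g_def U_g_def)
  obtain te x where x: "ivp_solution V g t0 \<phi> te x"
    and max: "\<And>te' x'. ivp_solution V g t0 \<phi> te' x' \<Longrightarrow> te' \<le> te \<and> (\<forall>\<tau>. ereal \<tau> < te' \<longrightarrow> x' \<tau> = x \<tau>)"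
    using ivp_solution_maximal[OF V] by metis
  define m where "m = te - ereal t0"
  define y where "y u = (t0 + u, x (t0 + u))" for u
  have y: "?sol m y"
    unfolding m_def y_def by (rule ivp_solution_imp_auto_ivp_solution[OF x])
  \<comment> \<open>The greatest-solution property is transferred: an autonomous solution projects
    to a solution \<open>x'\<close> that \<open>x\<close> extends, and the first components agree
    because both are the clock.\<close>
  have restr: "m' \<le> m \<and> (\<forall>u. ereal u < m' \<longrightarrow> y' u = y u)" if y': "?sol m' y'" for m' y'
  proof -
    \<comment> \<open>Puts the end time into the shifted form of the transfer lemma; this is valid
      for infinite \<open>m'\<close> as well.\<close>
    have m': "m' = (m' + ereal t0) - ereal t0" by (cases m') auto
    have "ivp_solution V g t0 \<phi> (m' + ereal t0) (\<lambda>\<tau>. snd (y' (\<tau> - t0)))"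
      using y' m' by (intro auto_ivp_solution_imp_ivp_solution) simp
    from max[OF this] have le: "m' + ereal t0 \<le> te"
      and eq: "\<And>\<tau>. ereal \<tau> < m' + ereal t0 \<Longrightarrow> snd (y' (\<tau> - t0)) = x \<tau>" by auto
    have "m' \<le> m" using le m' unfolding m_def by (metis ereal_minus_mono order_refl)
    moreover have "y' u = y u" if "ereal u < m'" for u
    proof -
      have "ereal (t0 + u) < m' + ereal t0"
        using that m' ereal_less_minus_real[of u "m' + ereal t0" t0] by simp
      from eq[OF this] show ?thesis
        using auto_ivp_solution_time[OF y' that] by (simp add: y_def prod_eq_iff)
    qed
    ultimately show ?thesis by blast
  qed
  have "?max m y"
    unfolding auto_maximal_solution_def using y restr by (blast intro: antisym)
  \<comment> \<open>Since \<open>y\<close> extends \<open>y'\<close>, maximality of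
    \<open>y'\<close> leaves no room for a longer life of \<open>y\<close>. This pins down the
    \<open>THE\<close> in \<open>max_time\<close>.\<close>
  moreover have "m' = m" if "?max m' y'" for m' y'
  proof -
    have "?sol m' y'" using that by (simp add: auto_maximal_solution_def)
    from restr[OF this] have "m' \<le> m" "\<forall>u. ereal u < m' \<longrightarrow> y u = y' u" by auto
    then have "m = m'" using that y unfolding auto_maximal_solution_def by blast
    then show ?thesis ..
  qed
  ultimately have time: "max_time (U_g V) (f_g g) ?\<psi> = m"
    unfolding max_time_def by (intro the_equality) blast+
  \<comment> \<open>\<open>max_sol\<close> is an arbitrary choice off the domain, so
    \<open>z\<close> and \<open>y\<close> are compared only below \<open>m\<close>; that suffices
    for the segment at \<open>t - t0\<close>.\<close>
  define z where "z = max_sol (U_g V) (f_g g) ?\<psi>"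
  have "?max m z"
    unfolding z_def max_sol_def time by (rule someI[of "?max m"]) (rule \<open>?max m y\<close>)
  then have z: "?sol m z" by (simp add: auto_maximal_solution_def)
  have t: "ereal (t - t0) < m" using dom by (simp add: process_dom_def Omega_g_def time)
  have "seg z (t - t0) = seg y (t - t0)"
    using restr[OF z] t by (intro seg_cong) (auto intro: ereal_le_less)
  then have "process V g t t0 \<phi> = p_n (seg y (t - t0))"
    by (simp add: process_def Sigma_g_def z_def)
  also have "\<dots> = seg x t"
    using p_n_seg[OF auto_ivp_solution_continuous[OF y t], of t0] by (simp add: y_def)
  finally have "process V g t t0 \<phi> = seg x t" .
  moreover have "ereal t < te" using t ereal_less_minus_real[of "t - t0" te t0] by (simp add: m_def)
  ultimately show "\<exists>te x. ivp_solution V g t0 \<phi> te x \<and>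
      (\<forall>te' x'. ivp_solution V g t0 \<phi> te' x' \<longrightarrow>
         te' \<le> te \<and> (\<forall>\<tau>. ereal \<tau> < te' \<longrightarrow> x' \<tau> = x \<tau>)) \<and>
      ereal t < te \<and> process V g t t0 \<phi> = seg x t"
    using x max by blast
qed

end
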